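(* Let $(\nu_n)_{n\ge1}$ be a sequence of strictly aperiodic probability measures on $\mathbb{Z}$ such that (1) $E(\nu_n)=\sum_{k}k\,\nu_n(k)=0$ for all $n$; (2) $\phi(n)=\sum_{i=1}^{n} m_2(\nu_i)=O(n)$, where $m_2(\nu)=\sum_k k^2\nu(k)$; (3) there exist a constant $C>0$ and an integer $N_0>0$ such that $|\hat{\nu}_n(t)|\le e^{-Ct^2}$ for all $n>N_0$ and all $t\in[-1/2,1/2)$. Let $\mu_n=\nu_1*\cdots*\nu_n$. Then for every $f\in L^1(X)$ the sequence $\mu_nf(x)=\sum_{k\in\mathbb{Z}}\mu_n(k)f(\tau^kx)$ converges for $m$-almost every $x\in X$.
   Context: $(X,\mathcal{B},m)$ is a non-atomic separable probability space and $\tau:X\to X$ is an invertible measure-preserving transformation. The Fourier transform of a probability measure $\mu$ on $\mathbb{Z}$ is $\hat{\mu}(t)=\sum_{k\in\mathbb{Z}}\mu(k)e^{2\pi ikt}$, $t\in[-1/2,1/2)$. Convolution: $(\mu*\nu)(k)=\sum_{j}\mu(k-j)\nu(j)$. A probability measure on $\mathbb{Z}$ is strictly aperiodic if its support is not contained in any proper coset of a subgroup of $\mathbb{Z}$. *)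

theory Defs
  imports "HOL-Probability.Probability" "HOL-Library.Landau_Symbols"
begin

definition prob_on_int :: "(int \<Rightarrow> real) \<Rightarrow> bool" where
  "prob_on_int \<nu> \<longleftrightarrow> (\<forall>k. 0 \<le> \<nu> k) \<and> (\<nu> has_sum 1) UNIV"

definition int_subgroup :: "int set \<Rightarrow> bool" where
  "int_subgroup H \<longleftrightarrow> 0 \<in> H \<and> (\<forall>a\<in>H. \<forall>b\<in>H. a + b \<in> H) \<and> (\<forall>a\<in>H. - a \<in> H)"

definition strictly_aperiodic :: "(int \<Rightarrow> real) \<Rightarrow> bool" where
  "strictly_aperiodic \<nu> \<longleftrightarrow>
     \<not> (\<exists>H a. int_subgroup H \<and> (\<lambda>h. a + h) ` H \<noteq> UNIV \<and> {k. \<nu> k \<noteq> 0} \<subseteq> (\<lambda>h. a + h) ` H)"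

definition mean_int :: "(int \<Rightarrow> real) \<Rightarrow> real" where
  "mean_int \<nu> = (\<Sum>\<^sub>\<infinity>k. real_of_int k * \<nu> k)"

definition m2 :: "(int \<Rightarrow> real) \<Rightarrow> real" where
  "m2 \<nu> = (\<Sum>\<^sub>\<infinity>k. (real_of_int k)\<^sup>2 * \<nu> k)"

definition fourier_int :: "(int \<Rightarrow> real) \<Rightarrow> real \<Rightarrow> complex" where
  "fourier_int \<nu> t = (\<Sum>\<^sub>\<infinity>k. complex_of_real (\<nu> k) * cis (2 * pi * real_of_int k * t))"

definition conv_int :: "(int \<Rightarrow> real) \<Rightarrow> (int \<Rightarrow> real) \<Rightarrow> int \<Rightarrow> real" where
  "conv_int \<mu> \<nu> k = (\<Sum>\<^sub>\<infinity>j. \<mu> (k - j) * \<nu> j)"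

fun mu_conv :: "(nat \<Rightarrow> int \<Rightarrow> real) \<Rightarrow> nat \<Rightarrow> int \<Rightarrow> real" where
  "mu_conv \<nu> 0 = (\<lambda>k. if k = 0 then 1 else 0)"
| "mu_conv \<nu> (Suc n) = conv_int (mu_conv \<nu> n) (\<nu> (Suc n))"

definition non_atomic :: "'a measure \<Rightarrow> bool" where
  "non_atomic M \<longleftrightarrow> (\<forall>A\<in>sets M. 0 < measure M A \<longrightarrow>
      (\<exists>B\<in>sets M. B \<subseteq> A \<and> 0 < measure M B \<and> measure M B < measure M A))"

definition separable_measure :: "'a measure \<Rightarrow> bool" where
  "separable_measure M \<longleftrightarrow> (\<exists>G. countable G \<and> G \<subseteq> sets M \<and>
      (\<forall>A\<in>sets M. \<forall>e>0. \<exists>B\<in>G. measure M ((A - B) \<union> (B - A)) < e))"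

definition invertible_mpt :: "'a measure \<Rightarrow> ('a \<Rightarrow> 'a) \<Rightarrow> bool" where
  "invertible_mpt M \<tau> \<longleftrightarrow> \<tau> \<in> measurable M M \<and> distr M M \<tau> = M \<and>
      bij_betw \<tau> (space M) (space M) \<and> inv_into (space M) \<tau> \<in> measurable M M \<and>
      distr M M (inv_into (space M) \<tau>) = M"

definition tpow :: "'a measure \<Rightarrow> ('a \<Rightarrow> 'a) \<Rightarrow> int \<Rightarrow> 'a \<Rightarrow> 'a" where
  "tpow M \<tau> k = (if 0 \<le> k then \<tau> ^^ nat k else inv_into (space M) \<tau> ^^ nat (- k))"

end

theory Submission
  imports Defs
begin

text \<open>Write \<open>F\<close>, \<open>F1\<close>, \<open>F2\<close> for the Fourier transforms of \<open>\<mu> n k\<close>, \<open>k * \<mu> n k\<close>, \<open>k\<^sup>2 * \<mu> n k\<close>.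
  Multiplication by \<open>k\<close> is a derivation for convolution, so the mean zero and second moment
  hypotheses together with the Gaussian decay give
  \<open>\<bar>F\<bar> \<lesssim> G\<close>, \<open>\<bar>F1\<bar> \<lesssim> n * \<bar>t\<bar> * G\<close>, \<open>\<bar>F2\<bar> \<lesssim> (n + n\<^sup>2 * t\<^sup>2) * G\<close>
  with \<open>G = exp (- C * n * t\<^sup>2)\<close>. Fourier inversion turns this into the pointwise bounds
  \<open>\<mu> n k \<lesssim> r / (r + \<bar>k\<bar>)\<^sup>2\<close> and \<open>\<bar>\<mu> n k - \<mu> n (k - 1)\<bar> \<lesssim> 1 / (r + \<bar>k\<bar>)\<^sup>2\<close>, \<open>r = sqrt n\<close>.
  The first kernel is decreasing in \<open>\<bar>k\<bar>\<close> with bounded sum, so the maximal function of \<open>\<mu> n\<close> is dominated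
  by the ergodic maximal functions of \<open>\<tau>\<close> and its inverse, which are of weak type (1,1). The second
  bound shows that \<open>\<mu> n\<close> annihilates bounded coboundaries in the limit. By the mean ergodic theorem
  for bounded functions, every integrable \<open>f\<close> is an invariant function plus a bounded coboundary plus
  an error of small \<open>L\<^sup>1\<close> norm.\<close>

section \<open>Fourier series on the integers\<close>

lemma abs_summable_conv_pairs:
  fixes G H :: "int \<Rightarrow> 'b::{real_normed_field,banach}"
  assumes G: "(\<lambda>k. norm (G k)) summable_on UNIV" and H: "(\<lambda>k. norm (H k)) summable_on UNIV"
  shows "(\<lambda>p. norm (case p of (k,j) \<Rightarrow> G (k - j) * H j)) summable_on UNIV"
    and "(\<Sum>\<^sub>\<infinity>(k,j)\<in>UNIV. G (k - j) * H j) = infsum G UNIV * infsum H UNIV"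
proof -
  have abs: "(\<lambda>p. norm (case p of (j,i) \<Rightarrow> G i * H j)) summable_on (UNIV \<times> UNIV)"
    unfolding Infinite_Sum.abs_summable_on_Sigma_iff
  proof (intro conjI ballI)
    fix j :: int
    show "(\<lambda>i. norm (case (j, i) of (j, i) \<Rightarrow> G i * H j)) summable_on UNIV"
      using G by (simp add: norm_mult summable_on_cmult_left)
    have "(\<lambda>j. (\<Sum>\<^sub>\<infinity>i. norm (G i)) * norm (H j)) summable_on UNIV"
      using H by (rule summable_on_cmult_right)
    then have "(\<lambda>j. \<Sum>\<^sub>\<infinity>i. norm (G i) * norm (H j)) summable_on UNIV"
      by (simp add: infsum_cmult_left')
    then show "(\<lambda>j. norm (\<Sum>\<^sub>\<infinity>i. norm (case (j, i) of (j, i) \<Rightarrow> G i * H j))) summable_on UNIV"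
      by (simp add: norm_mult infsum_nonneg)
  qed
  show "(\<lambda>p. norm (case p of (k,j) \<Rightarrow> G (k - j) * H j)) summable_on UNIV"
    using abs
    \<comment> \<open>The shear taking (k,j) to (j, k - j) is a bijection of the integer lattice; it
      turns the convolution double sum into a product double sum, whose absolute summability is
      \<open>abs\<close>.\<close>
    by (subst summable_on_reindex_bij_witness[where i = "\<lambda>(j,i). (i + j, j)" and j = "\<lambda>(k,j). (j, k - j)"
          and T = "UNIV \<times> UNIV" and h = "\<lambda>p. norm (case p of (j,i) \<Rightarrow> G i * H j)"]) auto
  have "(\<Sum>\<^sub>\<infinity>(k,j)\<in>UNIV. G (k - j) * H j) = (\<Sum>\<^sub>\<infinity>(j,i)\<in>UNIV\<times>UNIV. G i * H j)"
    by (rule infsum_reindex_bij_witness[where i = "\<lambda>(j,i). (i + j, j)" and j = "\<lambda>(k,j). (j, k - j)"]) auto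
  also have "\<dots> = (\<Sum>\<^sub>\<infinity>j. \<Sum>\<^sub>\<infinity>i. G i * H j)"
    using infsum_Sigma'_banach[OF abs_summable_summable[OF abs]] by simp
  also have "\<dots> = infsum G UNIV * infsum H UNIV"
    by (simp add: infsum_cmult_left' infsum_cmult_right')
  finally show "(\<Sum>\<^sub>\<infinity>(k,j)\<in>UNIV. G (k - j) * H j) = infsum G UNIV * infsum H UNIV" .
qed

text \<open>Fubini for the absolutely summable double sum. The general normed field covers both real
  sequences and their products with complex characters.\<close>

lemma has_sum_conv:
  fixes G H :: "int \<Rightarrow> 'b::{real_normed_field,banach}"
  assumes G: "(\<lambda>k. norm (G k)) summable_on UNIV" and H: "(\<lambda>k. norm (H k)) summable_on UNIV"
  shows "((\<lambda>k. \<Sum>\<^sub>\<infinity>j. G (k - j) * H j) has_sum infsum G UNIV * infsum H UNIV) UNIV"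
    and "(\<lambda>j. G (k - j) * H j) summable_on UNIV"
proof -
  have s: "(\<lambda>(k,j). G (k - j) * H j) summable_on UNIV \<times> UNIV"
    using abs_summable_summable[OF abs_summable_conv_pairs(1)[OF G H]] by simp
  show "(\<lambda>j. G (k - j) * H j) summable_on UNIV"
    using abs_summable_conv_pairs(1)[OF G H] Infinite_Sum.abs_summable_on_Sigma_iff[of "\<lambda>(k,j). G (k - j) * H j" UNIV "\<lambda>_. UNIV"]
    by (intro abs_summable_summable[where f = "\<lambda>j. G (k - j) * H j"]) simp
  show "((\<lambda>k. \<Sum>\<^sub>\<infinity>j. G (k - j) * H j) has_sum infsum G UNIV * infsum H UNIV) UNIV"
    using infsum_Sigma'_banach[OF s] summable_on_Sigma_banach[OF s] abs_summable_conv_pairs(2)[OF G H]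
    by (simp add: has_sum_iff)
qed

lemma real_abs_summable:
  fixes g :: "'i \<Rightarrow> real"
  shows "g summable_on A \<Longrightarrow> (\<lambda>k. norm (g k)) summable_on A"
  by (rule summable_on_iff_abs_summable_on_real[THEN iffD1])

lemma conv_int_has_sum:
  assumes "g summable_on UNIV" and "h summable_on UNIV"
  shows "(conv_int g h has_sum infsum g UNIV * infsum h UNIV) UNIV"
    and "(\<lambda>j. g (k - j) * h j) summable_on UNIV"
  using has_sum_conv[OF real_abs_summable real_abs_summable, OF assms]
  by (simp_all add: conv_int_def[abs_def])

lemma conv_int_summable:
  "g summable_on UNIV \<Longrightarrow> h summable_on UNIV \<Longrightarrow> conv_int g h summable_on UNIV"
  using conv_int_has_sum(1) has_sum_imp_summable by blast

section \<open>The Fourier transform and convolution\<close>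

lemma fourier_abs_summable:
  assumes "g summable_on UNIV"
  shows "(\<lambda>k::int. norm (complex_of_real (g k) * cis (2 * pi * real_of_int k * t))) summable_on UNIV"
  using real_abs_summable[OF assms] by (simp add: norm_mult)

lemmas fourier_summable = abs_summable_summable[OF fourier_abs_summable]

text \<open>The character at \<open>k\<close> factors into those at \<open>k - j\<close> and
  \<open>j\<close>, so attaching it before or after convolving gives the same sequence; the total of
  a convolution is the product of the totals.\<close>

lemma fourier_conv:
  assumes "g summable_on UNIV" and "h summable_on UNIV"
  shows "fourier_int (conv_int g h) t = fourier_int g t * fourier_int h t"
proof -
  let ?F = "\<lambda>g k. complex_of_real (g k) * cis (2 * pi * real_of_int k * t)"
  have "(\<Sum>\<^sub>\<infinity>j. ?F g (k - j) * ?F h j) = ?F (conv_int g h) k" for k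
  proof -
    have "?F g (k - j) * ?F h j = complex_of_real (g (k - j) * h j) * cis (2 * pi * real_of_int k * t)" for j
      by (simp add: cis_mult algebra_simps add_divide_distrib)
    then have "(\<Sum>\<^sub>\<infinity>j. ?F g (k - j) * ?F h j)
        = (\<Sum>\<^sub>\<infinity>j. complex_of_real (g (k - j) * h j)) * cis (2 * pi * real_of_int k * t)"
      by (simp only: infsum_cmult_left')
    also have "(\<Sum>\<^sub>\<infinity>j. complex_of_real (g (k - j) * h j)) = complex_of_real (conv_int g h k)"
      unfolding conv_int_def
      by (rule infsumI, rule has_sum_of_real, rule has_sum_infsum, rule conv_int_has_sum(2)[OF assms])
    finally show ?thesis .
  qed
  then show ?thesis
    using infsumI[OF has_sum_conv(1)[OF fourier_abs_summable[OF assms(1)] fourier_abs_summable[OF assms(2)], of t t]]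
    by (simp add: fourier_int_def)
qed

lemma fourier_add:
  assumes "g summable_on UNIV" and "h summable_on UNIV"
  shows "fourier_int (\<lambda>k. g k + h k) t = fourier_int g t + fourier_int h t"
  unfolding fourier_int_def
  by (subst infsum_add[symmetric])
    (simp_all only: fourier_summable[OF assms(1)] fourier_summable[OF assms(2)] of_real_add distrib_right)

lemma fourier_cmult: "fourier_int (\<lambda>k. c * g k) t = of_real c * fourier_int g t"
  by (simp add: fourier_int_def infsum_cmult_right' mult.assoc)

lemma fourier_shift:
  "fourier_int (\<lambda>k. g (k - 1)) t = cis (2 * pi * t) * fourier_int g t"
proof -
  have "(\<Sum>\<^sub>\<infinity>k. complex_of_real (g (k - 1)) * cis (2 * pi * real_of_int k * t))
     = (\<Sum>\<^sub>\<infinity>k. cis (2 * pi * t) * (complex_of_real (g k) * cis (2 * pi * real_of_int k * t)))"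
  proof (rule infsum_reindex_bij_witness[where i = "\<lambda>k. k + 1" and j = "\<lambda>k. k - 1"])
    fix k :: int
    have "cis (2 * pi * t) * cis (2 * pi * real_of_int (k - 1) * t) = cis (2 * pi * real_of_int k * t)"
      by (simp add: cis_mult algebra_simps)
    then show "cis (2 * pi * t) * (complex_of_real (g (k - 1)) * cis (2 * pi * real_of_int (k - 1) * t))
        = complex_of_real (g (k - 1)) * cis (2 * pi * real_of_int k * t)"
      by (metis mult.left_commute)
  qed auto
  also have "\<dots> = cis (2 * pi * t) * fourier_int g t"
    unfolding fourier_int_def by (rule infsum_cmult_right')
  finally show ?thesis unfolding fourier_int_def .
qed

lemma norm_fourier_le:
  assumes "g summable_on UNIV"
  shows "norm (fourier_int g t) \<le> (\<Sum>\<^sub>\<infinity>k. \<bar>g k\<bar>)"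
  using norm_infsum_bound[OF fourier_abs_summable[OF assms, of t]] by (simp add: fourier_int_def norm_mult)

text \<open>A chord is no longer than its arc: the left side equals
  \<open>2 * \<bar>sin (x/2)\<bar>\<close>.\<close>

lemma norm_cis_diff_le: "norm (1 - cis x) \<le> \<bar>x\<bar>"
proof -
  have "norm (1 - cis x) ^ 2 = 2 - 2 * cos x"
    using sin_cos_squared_add[of x]
    by (simp add: cmod_def power2_eq_square algebra_simps)
  also have "\<dots> = 4 * (sin (x/2))\<^sup>2"
    using cos_double_sin[of "x/2"] by simp
  also have "\<dots> \<le> 4 * (x/2)\<^sup>2"
    using abs_sin_x_le_abs_x[of "x/2"] by (simp only: abs_le_square_iff mult_le_cancel_left) simp
  also have "\<dots> = \<bar>x\<bar>\<^sup>2" by (simp add: power2_eq_square)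
  finally show ?thesis by (rule power2_le_imp_le) simp
qed

section \<open>Moments as weighted sequences\<close>

lemma int_abs_le_square: "\<bar>real_of_int k\<bar> \<le> (real_of_int k)\<^sup>2"
proof -
  have "\<bar>k\<bar> \<le> k\<^sup>2"
    using mult_right_mono[of 1 "\<bar>k\<bar>" "\<bar>k\<bar>"] by (cases "k = 0") (auto simp: power2_eq_square)
  then show ?thesis by (metis of_int_abs of_int_le_iff of_int_power)
qed

text \<open>Formally, (2 pi i)^p times the transform of \<open>weight p g\<close> is the p-th
  derivative of the transform of \<open>g\<close>. Weighting the coefficients gives access to
  derivatives without differentiating any series.\<close>

definition weight :: "nat \<Rightarrow> (int \<Rightarrow> real) \<Rightarrow> int \<Rightarrow> real" where
  "weight p g k = real_of_int k ^ p * g k"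

definition fin_m2 :: "(int \<Rightarrow> real) \<Rightarrow> bool" where
  "fin_m2 g \<longleftrightarrow> g summable_on UNIV \<and> weight 2 g summable_on UNIV"

lemma fin_m2_weight:
  assumes "fin_m2 g" shows "g summable_on UNIV" "weight 1 g summable_on UNIV" "weight 2 g summable_on UNIV"
proof -
  have "(\<lambda>k. norm (weight 1 g k)) summable_on UNIV"
    by (rule Infinite_Sum.abs_summable_on_comparison_test[where g = "weight 2 g"])
      (use assms real_abs_summable[of "weight 2 g"] in \<open>auto simp: fin_m2_def weight_def abs_mult
        intro!: mult_right_mono int_abs_le_square\<close>)
  then show "weight 1 g summable_on UNIV" by (rule summable_on_iff_abs_summable_on_real[THEN iffD2])
qed (use assms in \<open>auto simp: fin_m2_def\<close>)

text \<open>Write \<open>k = (k - j) + j\<close> under the convolution sum and expand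
  \<open>k\<close> and its square; summability of all the weighted sequences allows the sum to be
  split.\<close>

lemma weight_conv:
  assumes g: "fin_m2 g" and h: "fin_m2 h"
  shows "weight 1 (conv_int g h) = (\<lambda>k. conv_int (weight 1 g) h k + conv_int g (weight 1 h) k)"
    and "weight 2 (conv_int g h) = (\<lambda>k. conv_int (weight 2 g) h k + 2 * conv_int (weight 1 g) (weight 1 h) k
              + conv_int g (weight 2 h) k)"
proof -
  note s = conv_int_has_sum(2)[OF fin_m2_weight(1)[OF g] fin_m2_weight(1)[OF h]]
    conv_int_has_sum(2)[OF fin_m2_weight(2)[OF g] fin_m2_weight(1)[OF h]]
    conv_int_has_sum(2)[OF fin_m2_weight(1)[OF g] fin_m2_weight(2)[OF h]]
    conv_int_has_sum(2)[OF fin_m2_weight(3)[OF g] fin_m2_weight(1)[OF h]]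
    conv_int_has_sum(2)[OF fin_m2_weight(2)[OF g] fin_m2_weight(2)[OF h]]
    conv_int_has_sum(2)[OF fin_m2_weight(1)[OF g] fin_m2_weight(3)[OF h]]
  show "weight 1 (conv_int g h) = (\<lambda>k. conv_int (weight 1 g) h k + conv_int g (weight 1 h) k)"
  proof
    fix k
    have "((\<lambda>j. weight 1 g (k - j) * h j + g (k - j) * weight 1 h j) has_sum
        conv_int (weight 1 g) h k + conv_int g (weight 1 h) k) UNIV"
      unfolding conv_int_def by (intro has_sum_add has_sum_infsum s)
    moreover have "weight 1 g (k - j) * h j + g (k - j) * weight 1 h j = real_of_int k * (g (k - j) * h j)" for j
      by (simp add: weight_def algebra_simps)
    ultimately have "((\<lambda>j. real_of_int k * (g (k - j) * h j)) has_sum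
        conv_int (weight 1 g) h k + conv_int g (weight 1 h) k) UNIV" by simp
    from infsumI[OF this] show "weight 1 (conv_int g h) k = conv_int (weight 1 g) h k + conv_int g (weight 1 h) k"
      by (simp only: infsum_cmult_right' weight_def conv_int_def power_one_right)
  qed
  show "weight 2 (conv_int g h) = (\<lambda>k. conv_int (weight 2 g) h k + 2 * conv_int (weight 1 g) (weight 1 h) k
              + conv_int g (weight 2 h) k)"
  proof
    fix k
    have "((\<lambda>j. weight 2 g (k - j) * h j + 2 * (weight 1 g (k - j) * weight 1 h j) + g (k - j) * weight 2 h j) has_sum
        conv_int (weight 2 g) h k + 2 * conv_int (weight 1 g) (weight 1 h) k + conv_int g (weight 2 h) k) UNIV"
      unfolding conv_int_def by (intro has_sum_add has_sum_cmult_right has_sum_infsum s)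
    moreover have "weight 2 g (k - j) * h j + 2 * (weight 1 g (k - j) * weight 1 h j) + g (k - j) * weight 2 h j
          = (real_of_int k)\<^sup>2 * (g (k - j) * h j)" for j
      by (simp add: weight_def algebra_simps power2_eq_square)
    ultimately have "((\<lambda>j. (real_of_int k)\<^sup>2 * (g (k - j) * h j)) has_sum
        conv_int (weight 2 g) h k + 2 * conv_int (weight 1 g) (weight 1 h) k + conv_int g (weight 2 h) k) UNIV" by simp
    from infsumI[OF this] show "weight 2 (conv_int g h) k = conv_int (weight 2 g) h k
        + 2 * conv_int (weight 1 g) (weight 1 h) k + conv_int g (weight 2 h) k"
      unfolding weight_def[of 2 "conv_int g h"] conv_int_def[of g h] by (simp only: infsum_cmult_right')
  qed
qed

lemma fin_m2_conv:
  assumes g: "fin_m2 g" and h: "fin_m2 h" shows "fin_m2 (conv_int g h)"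
  unfolding fin_m2_def weight_conv(2)[OF assms]
  by (intro conjI summable_on_add summable_on_cmult_right conv_int_summable fin_m2_weight assms)

text \<open>The Leibniz rule of first and second order for a product of two transforms, read on the
  side of the coefficients.\<close>

lemma fourier_weight_conv:
  assumes g: "fin_m2 g" and h: "fin_m2 h"
  shows "fourier_int (weight 1 (conv_int g h)) t =
      fourier_int (weight 1 g) t * fourier_int h t + fourier_int g t * fourier_int (weight 1 h) t"
    and "fourier_int (weight 2 (conv_int g h)) t =
      fourier_int (weight 2 g) t * fourier_int h t
      + 2 * (fourier_int (weight 1 g) t * fourier_int (weight 1 h) t)
      + fourier_int g t * fourier_int (weight 2 h) t"
  unfolding weight_conv[OF assms]
  by (simp_all del: One_nat_def add: fourier_add fourier_cmult fourier_conv summable_on_add summable_on_cmult_right conv_int_summable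
     fin_m2_weight[OF g] fin_m2_weight[OF h])

text \<open>Only the upper bound of Fourier inversion is needed, so it suffices to integrate a finite
  partial sum of the series that carries all but \<open>e\<close> of the total mass.\<close>

lemma fourier_coeff_bound:
  assumes g: "g summable_on UNIV"
    and b: "\<And>t. t \<in> {-1/2..1/2} \<Longrightarrow> norm (fourier_int g t) \<le> b t"
    and I: "(b has_integral I) {-1/2..1/2}"
  shows "\<bar>g k\<bar> \<le> I"
proof (rule field_le_epsilon)
  fix e :: real assume "e > 0"
  have ga: "(\<lambda>k. \<bar>g k\<bar>) summable_on UNIV" using real_abs_summable[OF g] by simp
  obtain F where F: "finite F" "dist (sum (\<lambda>k. \<bar>g k\<bar>) F) (\<Sum>\<^sub>\<infinity>k. \<bar>g k\<bar>) \<le> e"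
    using infsum_finite_approximation[OF ga \<open>e > 0\<close>] by blast
  \<comment> \<open>The index \<open>k\<close> is added because orthogonality must later pick out
    \<open>g k\<close> from the partial sum; enlarging \<open>F\<close> only shrinks the
    tail.\<close>
  define F' where "F' = insert k F"
  have F': "finite F'" "k \<in> F'" using F by (auto simp: F'_def)
  let ?c = "\<lambda>k t. complex_of_real (g k) * cis (2 * pi * real_of_int k * t)"
  let ?p = "\<lambda>t. (\<Sum>j\<in>F'. ?c j t)"
  have split: "norm (?p t) \<le> b t + e" if "t \<in> {-1/2..1/2}" for t
  proof -
    have s: "(\<lambda>j. ?c j t) summable_on UNIV - F'"
      by (rule summable_on_subset_banach[OF fourier_summable[OF g]]) auto
    have "fourier_int g t - ?p t = (\<Sum>\<^sub>\<infinity>j\<in>UNIV - F'. ?c j t)"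
      unfolding fourier_int_def using infsum_Diff[OF fourier_summable[OF g], of t F'] F' by simp
    also have "norm \<dots> \<le> (\<Sum>\<^sub>\<infinity>j\<in>UNIV - F'. \<bar>g j\<bar>)"
      using norm_infsum_bound[of "\<lambda>j. ?c j t" "UNIV - F'"]
      by (simp add: norm_mult summable_on_subset_banach[OF ga])
    also have "\<dots> = (\<Sum>\<^sub>\<infinity>j. \<bar>g j\<bar>) - (\<Sum>j\<in>F'. \<bar>g j\<bar>)"
      using infsum_Diff[OF ga, of F'] F' by simp
    also have "\<dots> \<le> (\<Sum>\<^sub>\<infinity>j. \<bar>g j\<bar>) - (\<Sum>j\<in>F. \<bar>g j\<bar>)"
      using F by (intro diff_left_mono sum_mono2) (auto simp: F'_def)
    also have "\<dots> \<le> e" using F(2) by (simp add: dist_real_def)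
    finally have "norm (fourier_int g t - ?p t) \<le> e" .
    then show ?thesis using b[OF that] norm_triangle_ineq4[of "fourier_int g t" "fourier_int g t - ?p t"] by simp
  qed
  have cis_int: "((\<lambda>t. cis (2 * pi * real_of_int m * t)) has_integral (if m = 0 then 1 else 0)) {-1/2..1/2}" for m :: int
  proof (cases "m = 0")
    case True
    then show ?thesis using has_integral_const_real[of "1::complex" "-1/2" "1/2"] by simp
  next
    case False
    define w where "w = 2 * pi * real_of_int m"
    have w: "w \<noteq> 0" using False by (simp add: w_def)
    have "((\<lambda>t. cis (w * t)) has_integral (cis (w * (1/2)) / (\<i> * w) - cis (w * (-1/2)) / (\<i> * w))) {-1/2..1/2}"
    proof (rule fundamental_theorem_of_calculus)
      fix t :: real
      have "((\<lambda>z. exp (\<i> * w * z) / (\<i> * w)) has_field_derivative exp (\<i> * w * complex_of_real t)) (at (of_real t))"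
        using w by (auto intro!: derivative_eq_intros)
      from has_vector_derivative_real_field[OF this, of "{-1/2..1/2}"]
      show "((\<lambda>t. cis (w * t) / (\<i> * w)) has_vector_derivative cis (w * t)) (at t within {-1/2..1/2})"
        by (simp add: cis_conv_exp mult.assoc)
    qed simp
    \<comment> \<open>The interval has length one and thus holds a whole number of periods, so the
      primitive takes equal values at both ends.\<close>
    moreover have "cis (w * (1/2)) = cis (w * (-1/2))"
    proof -
      have "cis (w * (1/2)) = cis (w * (-1/2) + 2 * pi * m)" by (simp add: w_def)
      also have "\<dots> = cis (w * (-1/2))" by (simp only: cis_mult[symmetric] cis_multiple_2pi Ints_of_int mult_1_right)
      finally show ?thesis .
    qed
    ultimately show ?thesis using False by (simp add: w_def)
  qed
  \<comment> \<open>Multiplying the partial sum by the conjugate of the character at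
    \<open>k\<close> lowers every frequency by \<open>k\<close>; only \<open>j = k\<close> survives
    the integration.\<close>
  have "((\<lambda>t. \<Sum>j\<in>F'. complex_of_real (g j) * cis (2 * pi * real_of_int (j - k) * t))
      has_integral (\<Sum>j\<in>F'. complex_of_real (g j) * (if j - k = 0 then 1 else 0))) {-1/2..1/2}"
    by (intro has_integral_sum F' has_integral_mult_right cis_int)
  also have "(\<Sum>j\<in>F'. complex_of_real (g j) * (if j - k = 0 then 1 else 0)) = complex_of_real (g k)"
    using F' by (simp add: if_distrib[of "(*) _"] cong: if_cong)
  finally have i1: "((\<lambda>t. \<Sum>j\<in>F'. complex_of_real (g j) * cis (2 * pi * real_of_int (j - k) * t))
      has_integral complex_of_real (g k)) {-1/2..1/2}" .
  have i2: "((\<lambda>t. b t + e) has_integral (I + e)) {-1/2..1/2}"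
    using has_integral_add[OF I has_integral_const_real[of e "-1/2" "1/2"]] by simp
  have "norm (integral {-1/2..1/2} (\<lambda>t. \<Sum>j\<in>F'. complex_of_real (g j) * cis (2 * pi * real_of_int (j - k) * t)))
      \<le> integral {-1/2..1/2} (\<lambda>t. b t + e)"
  proof (rule integral_norm_bound_integral)
    fix t :: real assume t: "t \<in> {-1/2..1/2}"
    have "(\<Sum>j\<in>F'. complex_of_real (g j) * cis (2 * pi * real_of_int (j - k) * t))
        = ?p t * cis (- (2 * pi * real_of_int k * t))"
    proof -
      have "cis (2 * pi * real_of_int (j - k) * t)
          = cis (2 * pi * real_of_int j * t) * cis (- (2 * pi * real_of_int k * t))" for j
        by (simp add: cis_mult algebra_simps)
      then show ?thesis by (simp only: sum_distrib_right mult.assoc)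
    qed
    then show "norm (\<Sum>j\<in>F'. complex_of_real (g j) * cis (2 * pi * real_of_int (j - k) * t)) \<le> b t + e"
      using split[OF t] by (simp add: norm_mult)
  qed (use i1 i2 in \<open>auto simp: integrable_on_def\<close>)
  then show "\<bar>g k\<bar> \<le> I + e"
    using i1 i2 by (simp add: integral_unique)
qed

text \<open>The transform has period one. This carries a bound on the half-open interval to the
  closed one, on which the integrals are taken.\<close>

lemma fourier_half: "fourier_int g (1/2) = fourier_int g (-1/2)"
proof -
  have "cis (2 * pi * real_of_int k * (1/2)) = cis (2 * pi * real_of_int k * (-1/2))" for k
  proof -
    have "cis (2 * pi * real_of_int k * (1/2)) = cis (2 * pi * real_of_int k * (-1/2) + 2 * pi * k)" by simp
    also have "\<dots> = cis (2 * pi * real_of_int k * (-1/2))"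
      by (simp only: cis_mult[symmetric] cis_multiple_2pi Ints_of_int mult_1_right)
    finally show ?thesis .
  qed
  then show ?thesis by (simp only: fourier_int_def)
qed

text \<open>A Cauchy majorant has an elementary primitive, the arctangent, whose total variation is
  at most \<open>pi\<close>; hence the factor \<open>pi / sqrt a\<close>.\<close>

lemma fourier_coeff_cauchy_bound:
  assumes g: "g summable_on UNIV" and a: "a > 0" and B: "B \<ge> 0"
    and b: "\<And>t. t \<in> {-1/2..1/2} \<Longrightarrow> norm (fourier_int g t) \<le> B / (1 + a * t\<^sup>2)"
  shows "\<bar>g k\<bar> \<le> B * pi / sqrt a"
proof -
  define s where "s = sqrt a"
  have s: "s > 0" "a = s\<^sup>2" using a by (auto simp: s_def)
  define J where "J = B / s * arctan (s * (1/2)) - B / s * arctan (s * (-1/2))"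
  have hi: "((\<lambda>t. B / (1 + a * t\<^sup>2)) has_integral J) {-1/2..1/2}"
    unfolding J_def
  proof (rule fundamental_theorem_of_calculus)
    fix t :: real
    have D: "((\<lambda>t. arctan (s * t)) has_field_derivative inverse (1 + (s * t)\<^sup>2) * s) (at t within {-1/2..1/2})"
      by (auto intro!: derivative_eq_intros)
    have "((\<lambda>t. B / s * arctan (s * t)) has_field_derivative B / (1 + a * t\<^sup>2)) (at t within {-1/2..1/2})"
    proof -
      have "B / s * (inverse (1 + (s * t)\<^sup>2) * s) = B / (1 + a * t\<^sup>2)"
        using s by (simp add: power_mult_distrib divide_inverse)
      then show ?thesis using DERIV_cmult[OF D, of "B / s"] by (simp only:)
    qed
    then show "((\<lambda>t. B / s * arctan (s * t)) has_vector_derivative B / (1 + a * t\<^sup>2)) (at t within {-1/2..1/2})"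
      by (simp add: has_real_derivative_iff_has_vector_derivative)
  qed simp
  have "\<bar>g k\<bar> \<le> J"
    using fourier_coeff_bound[OF g _ hi] b by blast
  also have "J = B * (2 * arctan (s/2)) / s"
    by (simp add: J_def arctan_minus[of "s/2"])
  also have "\<dots> \<le> B * pi / s"
    using arctan_ubound[of "s/2"] s B by (intro divide_right_mono mult_left_mono) auto
  finally show ?thesis by (simp add: s_def)
qed

text \<open>From \<open>1 + x / 3 \<le> exp (x / 3)\<close> follows
  \<open>(1 + x) ^ 3 \<le> 27 * exp x\<close>, which explains the constant. Two of the three powers
  of \<open>1 + x\<close> absorb \<open>y ^ j\<close>, the last is the denominator. Degree three is
  needed once a factor \<open>\<bar>t\<bar>\<close> meets a second moment.\<close>

lemma gauss_le_cauchy: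
  fixes y :: real
  assumes "y \<ge> 0" and "j \<le> 3"
  shows "y ^ j * exp (- y\<^sup>2) \<le> 27 / (1 + y\<^sup>2)"
proof -
  define x where "x = y\<^sup>2"
  have x: "x \<ge> 0" by (simp add: x_def)
  have y: "y ^ j \<le> (1 + x)\<^sup>2"
  proof -
    have "y ^ j \<le> max 1 y ^ j" using assms by (intro power_mono) auto
    also have "\<dots> \<le> max 1 y ^ 3" using assms by (intro power_increasing) auto
    also have "\<dots> \<le> (1 + x)\<^sup>2"
    proof (cases "y \<le> 1")
      case True
      then show ?thesis using x by (simp add: max_def power_increasing one_le_power)
    next
      case False
      then have "max 1 y ^ 3 \<le> y ^ 4" using power_increasing[of 3 4 y] by (simp add: max_def)
      also have "\<dots> = x\<^sup>2" by (simp add: x_def)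
      also have "\<dots> \<le> (1 + x)\<^sup>2" using x by (intro power_mono) auto
      finally show ?thesis .
    qed
    finally show ?thesis .
  qed
  have "((1 + x) / 3) ^ 3 \<le> (exp (x / 3)) ^ 3"
    using x exp_ge_add_one_self[of "x/3"] by (intro power_mono) (auto simp: field_simps)
  also have "\<dots> = exp x" by (simp add: exp_of_nat_mult[symmetric])
  finally have e: "(1 + x) ^ 3 \<le> 27 * exp x" by (simp add: power_divide)
  have "y ^ j * exp (- x) * (1 + x) \<le> (1 + x)\<^sup>2 * exp (- x) * (1 + x)"
    using x y by (intro mult_right_mono) auto
  also have "\<dots> = (1 + x) ^ 3 * exp (- x)" by (simp add: power2_eq_square power3_eq_cube)
  also have "\<dots> \<le> 27" using e by (simp add: exp_minus field_simps)
  finally show ?thesis using x by (simp add: x_def[symmetric] field_simps)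
qed

section \<open>Transforms of a single probability measure\<close>

lemma prob_on_intD:
  assumes "prob_on_int g"
  shows "g k \<ge> 0" "g summable_on UNIV" "infsum g UNIV = 1"
  using assms by (auto simp: prob_on_int_def has_sum_iff)

lemma m2_weight: "m2 g = infsum (weight 2 g) UNIV"
  by (simp add: m2_def weight_def[abs_def])

lemma m2_nonneg: "prob_on_int g \<Longrightarrow> m2 g \<ge> 0"
  unfolding m2_def by (intro infsum_nonneg) (simp add: prob_on_intD)

text \<open>The first two are bounds by total mass. In the third, the vanishing mean lets
  \<open>1\<close> be subtracted from each character; the bound for \<open>1 - cis x\<close> then
  yields a factor \<open>\<bar>t\<bar>\<close> at the price of one more power of
  \<open>k\<close>.\<close>

lemma fourier_prob_bounds:
  assumes p: "prob_on_int g" and f: "fin_m2 g"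
  shows "norm (fourier_int g t) \<le> 1"
    and "norm (fourier_int (weight 2 g) t) \<le> m2 g"
    and "mean_int g = 0 \<Longrightarrow> norm (fourier_int (weight 1 g) t) \<le> 2 * pi * \<bar>t\<bar> * m2 g"
proof -
  note pos = prob_on_intD(1)[OF p]
  show "norm (fourier_int g t) \<le> 1"
    using norm_fourier_le[OF prob_on_intD(2)[OF p], of t] pos prob_on_intD(3)[OF p] by simp
  show "norm (fourier_int (weight 2 g) t) \<le> m2 g"
    using norm_fourier_le[OF fin_m2_weight(3)[OF f], of t] pos by (simp add: m2_weight weight_def[abs_def] abs_mult)
  assume m: "mean_int g = 0"
  have "((\<lambda>k. complex_of_real (weight 1 g k)) has_sum complex_of_real (mean_int g)) UNIV"
    using has_sum_of_real[OF has_sum_infsum[OF fin_m2_weight(2)[OF f]]] by (simp add: mean_int_def weight_def[abs_def])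
  then have "((\<lambda>k. complex_of_real (weight 1 g k) * cis (2 * pi * real_of_int k * t) - complex_of_real (weight 1 g k))
      has_sum fourier_int (weight 1 g) t - 0) UNIV"
    unfolding m fourier_int_def
    using has_sum_add[OF has_sum_infsum[OF fourier_summable[OF fin_m2_weight(2)[OF f]]] has_sum_uminusI[of "\<lambda>k. complex_of_real (weight 1 g k)" UNIV 0]]
    by (simp del: One_nat_def)
  moreover have "((\<lambda>k. 2 * pi * \<bar>t\<bar> * weight 2 g k) has_sum 2 * pi * \<bar>t\<bar> * m2 g) UNIV"
    unfolding m2_weight by (intro has_sum_cmult_right has_sum_infsum fin_m2_weight(3)[OF f])
  ultimately have "norm (fourier_int (weight 1 g) t - 0) \<le> 2 * pi * \<bar>t\<bar> * m2 g"
  proof (rule norm_infsum_le)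
    fix k :: int
    have "norm (complex_of_real (weight 1 g k) * cis (2 * pi * real_of_int k * t) - complex_of_real (weight 1 g k))
       = \<bar>weight 1 g k\<bar> * norm (1 - cis (2 * pi * real_of_int k * t))"
    proof -
      have "complex_of_real (weight 1 g k) * cis (2 * pi * real_of_int k * t) - complex_of_real (weight 1 g k)
          = complex_of_real (weight 1 g k) * (cis (2 * pi * real_of_int k * t) - 1)"
        by (simp only: right_diff_distrib mult_1_right)
      then show ?thesis by (simp only: norm_mult norm_of_real norm_minus_commute[of 1])
    qed
    also have "\<dots> \<le> \<bar>weight 1 g k\<bar> * \<bar>2 * pi * real_of_int k * t\<bar>"
      by (intro mult_left_mono norm_cis_diff_le) auto
    also have "\<dots> = 2 * pi * \<bar>t\<bar> * (\<bar>real_of_int k\<bar> * \<bar>real_of_int k\<bar> * g k)"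
      using pos by (simp add: weight_def abs_mult)
    also have "\<dots> = 2 * pi * \<bar>t\<bar> * weight 2 g k"
      by (simp add: weight_def power2_eq_square)
    finally show "norm (complex_of_real (weight 1 g k) * cis (2 * pi * real_of_int k * t) - complex_of_real (weight 1 g k))
      \<le> 2 * pi * \<bar>t\<bar> * weight 2 g k" .
  qed
  then show "norm (fourier_int (weight 1 g) t) \<le> 2 * pi * \<bar>t\<bar> * m2 g" by simp
qed

lemma prob_conv_int:
  assumes g: "prob_on_int g" and h: "prob_on_int h" shows "prob_on_int (conv_int g h)"
  unfolding prob_on_int_def
proof (intro conjI allI)
  show "(conv_int g h has_sum 1) UNIV"
    using conv_int_has_sum(1)[of g h] prob_on_intD(2,3)[OF g] prob_on_intD(2,3)[OF h] by simp
  show "0 \<le> conv_int g h k" for k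
    unfolding conv_int_def by (intro infsum_nonneg) (simp add: prob_on_intD(1)[OF g] prob_on_intD(1)[OF h])
qed

section \<open>Decay of the convolution products\<close>

text \<open>The hypotheses in working form: decay on the closed interval, and an explicit linear
  bound valid from \<open>n = 1\<close> on in place of the Landau symbol.\<close>

locale conv_sequence =
  fixes \<nu> :: "nat \<Rightarrow> int \<Rightarrow> real" and C K :: real and N0 :: nat
  assumes prob: "n \<ge> 1 \<Longrightarrow> prob_on_int (\<nu> n)"
    and fin: "n \<ge> 1 \<Longrightarrow> fin_m2 (\<nu> n)"
    and mean: "n \<ge> 1 \<Longrightarrow> mean_int (\<nu> n) = 0"
    and C: "C > 0"
    and decay: "n > N0 \<Longrightarrow> t \<in> {-1/2..1/2} \<Longrightarrow> norm (fourier_int (\<nu> n) t) \<le> exp (- C * t\<^sup>2)"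
    and phi: "n \<ge> 1 \<Longrightarrow> (\<Sum>i=1..n. m2 (\<nu> i)) \<le> K * real n"
begin

abbreviation "\<mu> \<equiv> mu_conv \<nu>"
definition "\<phi> n = (\<Sum>i=1..n. m2 (\<nu> i))"
definition "q = exp (C / 4)"
definition "W n t = q ^ min n N0 * exp (- C * real n * t\<^sup>2)"

text \<open>For \<open>n \<le> N0\<close> only the trivial bound \<open>1\<close> on the Fourier transform of \<open>\<nu> n\<close> is available;
  the factor \<open>q\<close> pays for it, because \<open>exp (- C * t\<^sup>2) \<ge> 1 / q\<close> when \<open>\<bar>t\<bar> \<le> 1/2\<close>.\<close>

lemma mu_prob: "prob_on_int (\<mu> n)" and mu_fin: "fin_m2 (\<mu> n)"
proof (induction n)
  case 0
  have "(\<lambda>k::int. if k = 0 then 1 else 0 :: real) summable_on UNIV"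
    and "weight 2 (\<lambda>k::int. if k = 0 then 1 else 0 :: real) summable_on UNIV"
    by (auto intro!: finite_nonzero_values_imp_summable_on simp: weight_def intro: finite_subset[of _ "{0}"])
  moreover have "((\<lambda>k::int. if k = 0 then 1 else 0 :: real) has_sum 1) UNIV"
    by (rule has_sum_finite_neutralI[of "{0}"]) auto
  ultimately show "prob_on_int (\<mu> 0)" "fin_m2 (\<mu> 0)"
    by (auto simp: prob_on_int_def fin_m2_def)
next
  case (Suc n)
  then show "prob_on_int (\<mu> (Suc n))" "fin_m2 (\<mu> (Suc n))"
    by (simp_all add: prob_conv_int fin_m2_conv prob fin)
qed

lemma q: "q \<ge> 1" using C by (simp add: q_def)

lemma W_pos: "W n t > 0" by (simp add: W_def q_def)

lemma phi_Suc: "\<phi> (Suc n) = \<phi> n + m2 (\<nu> (Suc n))"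
  by (simp add: \<phi>_def)

lemma m2_nu: "n \<ge> 1 \<Longrightarrow> m2 (\<nu> n) \<ge> 0" by (simp add: m2_nonneg prob)

lemma phi_nonneg: "\<phi> n \<ge> 0" by (auto simp: \<phi>_def intro!: sum_nonneg m2_nu)

lemma gauss_lower: "t \<in> {-1/2..1/2} \<Longrightarrow> 1 \<le> q * exp (- C * t\<^sup>2)"
proof -
  assume "t \<in> {-1/2..1/2}"
  then have "t\<^sup>2 \<le> (1/2)\<^sup>2" by (intro abs_le_square_iff[THEN iffD1]) auto
  then have "C * t\<^sup>2 \<le> C * (1/4)" using C by (intro mult_left_mono) (auto simp: power2_eq_square)
  then show ?thesis by (simp add: q_def exp_add[symmetric])
qed

text \<open>The split at \<open>n < N0\<close> means \<open>Suc n \<le> N0\<close>, exactly the new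
  factors without decay. There \<open>min n N0\<close> grows by one and supplies the factor
  \<open>q\<close>; afterwards the Gaussian bound itself is available.\<close>

lemma W_Suc_mult:
  assumes "t \<in> {-1/2..1/2}"
  shows "W n t * norm (fourier_int (\<nu> (Suc n)) t) \<le> W (Suc n) t"
proof (cases "n < N0")
  case True
  have "W n t * norm (fourier_int (\<nu> (Suc n)) t) \<le> W n t * 1"
    using W_pos[of n t] fourier_prob_bounds(1)[OF prob fin] by (intro mult_left_mono) auto
  also have "\<dots> \<le> W n t * (q * exp (- C * t\<^sup>2))"
    using W_pos[of n t] gauss_lower[OF assms] by (intro mult_left_mono) auto
  also have "\<dots> = W (Suc n) t"
    using True by (simp add: W_def algebra_simps exp_add[symmetric] min_def)
  finally show ?thesis .
next
  case False
  have "W n t * norm (fourier_int (\<nu> (Suc n)) t) \<le> W n t * exp (- C * t\<^sup>2)"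
    using W_pos[of n t] False assms by (intro mult_left_mono decay) auto
  also have "\<dots> = W (Suc n) t"
    using False by (simp add: W_def algebra_simps exp_add[symmetric] min_def)
  finally show ?thesis .
qed

text \<open>Serves the Leibniz terms in which the new transform is differentiated: its decay is lost
  there, and one factor \<open>q\<close> makes up for it.\<close>

lemma W_le_W_Suc:
  assumes "t \<in> {-1/2..1/2}"
  shows "W n t \<le> q * W (Suc n) t"
proof -
  have "W n t = q ^ min n N0 * exp (- C * real n * t\<^sup>2) * 1" by (simp add: W_def)
  also have "\<dots> \<le> q ^ min (Suc n) N0 * exp (- C * real n * t\<^sup>2) * (q * exp (- C * t\<^sup>2))"
    using q gauss_lower[OF assms] by (intro mult_mono mult_right_mono power_increasing) auto
  also have "\<dots> = q * W (Suc n) t" by (simp add: W_def algebra_simps exp_add[symmetric])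
  finally show ?thesis .
qed

lemma norm_triangle_leibniz: "norm (a * b + 2 * (c * d) + e * f :: complex) \<le> norm a * norm b + 2 * (norm c * norm d) + norm e * norm f"
  using norm_triangle_ineq[of "a * b + 2 * (c * d)" "e * f"] norm_triangle_ineq[of "a * b" "2 * (c * d)"]
  by (simp add: norm_mult)

text \<open>Induction by the Leibniz rule. Where the new factor is not differentiated,
  \<open>W_Suc_mult\<close> advances the bound at no cost. Where it is, one \<open>q\<close> is
  paid, but such a term carries the increment \<open>m\<close> of \<open>\<phi>\<close>; so the
  powers of \<open>q\<close> do not accumulate with \<open>n\<close>.\<close>

lemma fourier_mu_bounds:
  assumes t: "t \<in> {-1/2..1/2}"
  shows "norm (fourier_int (\<mu> n) t) \<le> W n t"
    and "norm (fourier_int (weight 1 (\<mu> n)) t) \<le> 2 * pi * q * \<phi> n * \<bar>t\<bar> * W n t"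
    and "norm (fourier_int (weight 2 (\<mu> n)) t) \<le> (q * \<phi> n + 4 * pi\<^sup>2 * q\<^sup>2 * (\<phi> n)\<^sup>2 * t\<^sup>2) * W n t"
proof (induction n)
  case 0
  have "fourier_int (\<lambda>k. if k = 0 then 1 else 0) t = 1"
    unfolding fourier_int_def by (rule infsumI, rule has_sum_finite_neutralI[of "{0}"]) auto
  moreover have "fourier_int (weight p (\<lambda>k. if k = 0 then 1 else 0)) t = 0" if "p > 0" for p
    unfolding fourier_int_def by (rule infsum_0) (use that in \<open>auto simp: weight_def\<close>)
  ultimately show "norm (fourier_int (\<mu> 0) t) \<le> W 0 t"
    and "norm (fourier_int (weight 1 (\<mu> 0)) t) \<le> 2 * pi * q * \<phi> 0 * \<bar>t\<bar> * W 0 t"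
    and "norm (fourier_int (weight 2 (\<mu> 0)) t) \<le> (q * \<phi> 0 + 4 * pi\<^sup>2 * q\<^sup>2 * (\<phi> 0)\<^sup>2 * t\<^sup>2) * W 0 t"
    by (simp_all del: One_nat_def add: W_def \<phi>_def)
next
  case (Suc n)
  define m where "m = m2 (\<nu> (Suc n))"
  define V where "V = W (Suc n) t"
  define v where "v = norm (fourier_int (\<nu> (Suc n)) t)"
  have pf: "prob_on_int (\<nu> (Suc n))" "fin_m2 (\<nu> (Suc n))" and mz: "mean_int (\<nu> (Suc n)) = 0"
    using prob fin mean by auto
  have m: "m \<ge> 0" using m2_nonneg[OF pf(1)] by (simp add: m_def)
  have v: "v \<ge> 0" by (simp add: v_def)
  have V: "V > 0" using W_pos by (simp add: V_def)
  have Wv: "W n t * v \<le> V" using W_Suc_mult[OF t] by (simp add: v_def V_def)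
  have WV: "W n t \<le> q * V" using W_le_W_Suc[OF t] by (simp add: V_def)
  have q0: "q > 0" using q by simp
  have n1: "norm (fourier_int (weight 1 (\<nu> (Suc n))) t) \<le> 2 * pi * \<bar>t\<bar> * m"
    using fourier_prob_bounds(3)[OF pf mz] by (simp add: m_def)
  have n2: "norm (fourier_int (weight 2 (\<nu> (Suc n))) t) \<le> m"
    using fourier_prob_bounds(2)[OF pf] by (simp add: m_def)
  have W0: "W n t > 0" by (rule W_pos)
  have p0: "\<phi> n \<ge> 0" by (rule phi_nonneg)
  have ps: "\<phi> (Suc n) = \<phi> n + m" by (simp add: phi_Suc m_def)
  show "norm (fourier_int (\<mu> (Suc n)) t) \<le> W (Suc n) t"
  proof -
    have "norm (fourier_int (\<mu> (Suc n)) t) = norm (fourier_int (\<mu> n) t) * v"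
      by (simp add: fourier_conv fin_m2_weight(1)[OF mu_fin] fin_m2_weight(1)[OF pf(2)] norm_mult v_def)
    also have "\<dots> \<le> W n t * v" using Suc.IH(1) v by (rule mult_right_mono)
    finally show ?thesis using Wv by (simp add: V_def)
  qed
  show "norm (fourier_int (weight 1 (\<mu> (Suc n))) t) \<le> 2 * pi * q * \<phi> (Suc n) * \<bar>t\<bar> * W (Suc n) t"
  proof -
    have "norm (fourier_int (weight 1 (\<mu> (Suc n))) t) \<le> norm (fourier_int (weight 1 (\<mu> n)) t) * v
        + norm (fourier_int (\<mu> n) t) * norm (fourier_int (weight 1 (\<nu> (Suc n))) t)"
      unfolding mu_conv.simps fourier_weight_conv(1)[OF mu_fin pf(2)] v_def norm_mult[symmetric]
      by (rule norm_triangle_ineq)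
    also have "\<dots> \<le> (2 * pi * q * \<phi> n * \<bar>t\<bar> * W n t) * v + W n t * (2 * pi * \<bar>t\<bar> * m)"
      using Suc.IH n1 v W0 q0 p0 by (intro add_mono mult_mono) (auto intro!: mult_nonneg_nonneg)
    also have "\<dots> = 2 * pi * \<bar>t\<bar> * (q * \<phi> n * (W n t * v) + m * W n t)"
      by (simp add: algebra_simps)
    also have "\<dots> \<le> 2 * pi * \<bar>t\<bar> * (q * \<phi> n * V + m * (q * V))"
      using Wv WV p0 m q0 by (intro mult_left_mono add_mono) auto
    also have "\<dots> = 2 * pi * q * \<phi> (Suc n) * \<bar>t\<bar> * W (Suc n) t"
      by (simp add: ps V_def algebra_simps)
    finally show ?thesis .
  qed
  show "norm (fourier_int (weight 2 (\<mu> (Suc n))) t)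
      \<le> (q * \<phi> (Suc n) + 4 * pi\<^sup>2 * q\<^sup>2 * (\<phi> (Suc n))\<^sup>2 * t\<^sup>2) * W (Suc n) t"
  proof -
    have "norm (fourier_int (weight 2 (\<mu> (Suc n))) t) \<le> norm (fourier_int (weight 2 (\<mu> n)) t) * v
        + 2 * (norm (fourier_int (weight 1 (\<mu> n)) t) * norm (fourier_int (weight 1 (\<nu> (Suc n))) t))
        + norm (fourier_int (\<mu> n) t) * norm (fourier_int (weight 2 (\<nu> (Suc n))) t)"
      unfolding mu_conv.simps fourier_weight_conv(2)[OF mu_fin pf(2)] v_def
      by (rule norm_triangle_leibniz)
    also have "\<dots> \<le> ((q * \<phi> n + 4 * pi\<^sup>2 * q\<^sup>2 * (\<phi> n)\<^sup>2 * t\<^sup>2) * W n t) * v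
        + 2 * ((2 * pi * q * \<phi> n * \<bar>t\<bar> * W n t) * (2 * pi * \<bar>t\<bar> * m)) + W n t * m"
      using Suc.IH n1 n2 v W0 q0 p0 m by (intro add_mono mult_mono mult_left_mono) (auto intro!: mult_nonneg_nonneg add_nonneg_nonneg)
    also have "\<dots> = (q * \<phi> n + 4 * pi\<^sup>2 * q\<^sup>2 * (\<phi> n)\<^sup>2 * t\<^sup>2) * (W n t * v)
        + (8 * pi\<^sup>2 * q * \<phi> n * t\<^sup>2 * m) * W n t + m * W n t"
      by (simp add: power2_eq_square algebra_simps)
    also have "\<dots> \<le> (q * \<phi> n + 4 * pi\<^sup>2 * q\<^sup>2 * (\<phi> n)\<^sup>2 * t\<^sup>2) * V
        + (8 * pi\<^sup>2 * q * \<phi> n * t\<^sup>2 * m) * (q * V) + m * (q * V)"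
      using Wv WV p0 m q0 by (intro add_mono mult_left_mono) auto
    \<comment> \<open>The mixed Leibniz term is the cross term \<open>2 * \<phi> n * m\<close> of
      the square of \<open>\<phi> n + m\<close>; only the square of \<open>m\<close> is
      missing.\<close>
    also have "\<dots> = (q * \<phi> (Suc n) + 4 * pi\<^sup>2 * q\<^sup>2 * ((\<phi> (Suc n))\<^sup>2 - m\<^sup>2) * t\<^sup>2) * V"
      by (simp add: ps power2_eq_square algebra_simps)
    also have "\<dots> \<le> (q * \<phi> (Suc n) + 4 * pi\<^sup>2 * q\<^sup>2 * (\<phi> (Suc n))\<^sup>2 * t\<^sup>2) * V"
      using V by (intro mult_right_mono add_left_mono mult_left_mono) auto
    finally show ?thesis by (simp add: V_def)
  qed
qed

end

text \<open>The bound on \<open>u\<close> is effective for \<open>\<bar>k\<bar> \<le> r\<close>, the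
  one on its second moment beyond. Both combine through (r + |k|)^2 <= 2 r^2 + 2 k^2.\<close>

lemma kernel_decay:
  fixes u r D :: real
  assumes r: "r > 0" and 1: "\<bar>u\<bar> \<le> D / r" and 2: "k\<^sup>2 * \<bar>u\<bar> \<le> D * r"
  shows "\<bar>u\<bar> \<le> 4 * D * (r / (r + \<bar>k\<bar>)\<^sup>2)"
proof -
  have "0 \<le> (r - \<bar>k\<bar>)\<^sup>2" by simp
  then have "(r + \<bar>k\<bar>)\<^sup>2 \<le> 2 * r\<^sup>2 + 2 * k\<^sup>2" by (simp add: power2_eq_square algebra_simps)
  then have "(r + \<bar>k\<bar>)\<^sup>2 * \<bar>u\<bar> \<le> (2 * r\<^sup>2 + 2 * k\<^sup>2) * \<bar>u\<bar>" by (intro mult_right_mono) auto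
  also have "\<dots> = 2 * r * (r * \<bar>u\<bar>) + 2 * (k\<^sup>2 * \<bar>u\<bar>)" by (simp add: power2_eq_square algebra_simps)
  also have "\<dots> \<le> 2 * r * D + 2 * (D * r)"
    using 1 2 r by (intro add_mono mult_left_mono) (auto simp: field_simps)
  finally have "(r + \<bar>k\<bar>)\<^sup>2 * \<bar>u\<bar> \<le> 4 * D * r" by simp
  moreover have "(r + \<bar>k\<bar>)\<^sup>2 > 0" using r by (simp add: add_pos_nonneg)
  ultimately show ?thesis by (simp add: field_simps)
qed

section \<open>Pointwise bounds for the convolution products\<close>

context conv_sequence
begin

text \<open>\<open>A\<close> bounds the prefactor of \<open>W\<close> for all \<open>n\<close>,
  \<open>c\<close> is the scale in \<open>y = c * r * \<bar>t\<bar>\<close>, and \<open>B\<close>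
  adds up the constants of the five estimates that follow, so that one constant serves them
  all.\<close>

definition "A = q ^ N0"
definition "c = sqrt C"
definition "B = 27 * (A + A / c + 2 * pi * q * K * A / c + (q * K + 4 * pi\<^sup>2 * q\<^sup>2 * K\<^sup>2 / C) * A * (1 + 1 / c))"

lemma K_nonneg: "K \<ge> 0"
  using phi[of 1] m2_nu[of 1] by simp

text \<open>In the variable \<open>y = c * r * \<bar>t\<bar>\<close> each quantity is bounded by a
  power of \<open>r\<close> times a polynomial in \<open>y\<close> of degree at most three times
  \<open>exp (- y\<^sup>2)\<close>. The last two bounds serve the differences of
  \<open>\<mu> n\<close>, whose transform has the factor \<open>1 - cis (2 * pi * t)\<close> of size
  \<open>\<bar>t\<bar>\<close>.\<close>

lemma fourier_mu_decay:
  assumes n: "n \<ge> 1" and t: "t \<in> {-1/2..1/2}"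
  defines "r \<equiv> sqrt (real n)"
  shows "norm (fourier_int (\<mu> n) t) \<le> B / (1 + C * n * t\<^sup>2)"
    and "norm (fourier_int (weight 1 (\<mu> n)) t) \<le> B * r / (1 + C * n * t\<^sup>2)"
    and "norm (fourier_int (weight 2 (\<mu> n)) t) \<le> B * r\<^sup>2 / (1 + C * n * t\<^sup>2)"
    and "\<bar>t\<bar> * norm (fourier_int (\<mu> n) t) \<le> B / r / (1 + C * n * t\<^sup>2)"
    and "\<bar>t\<bar> * norm (fourier_int (weight 2 (\<mu> n)) t) \<le> B * r / (1 + C * n * t\<^sup>2)"
proof -
  define y where "y = c * r * \<bar>t\<bar>"
  define e where "e = exp (- y\<^sup>2)"
  define G where "G = 27 / (1 + C * n * t\<^sup>2)"
  define L where "L = q * K"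
  define M where "M = 4 * pi\<^sup>2 * q\<^sup>2 * K\<^sup>2 / C"
  have c: "c > 0" "c\<^sup>2 = C" using C by (auto simp: c_def)
  have r: "r > 0" "r\<^sup>2 = n" using n by (auto simp: r_def)
  have y: "y \<ge> 0" using c r by (simp add: y_def)
  have y2: "y\<^sup>2 = C * n * t\<^sup>2" by (simp add: y_def power_mult_distrib c r)
  have ty: "\<bar>t\<bar> = y / (c * r)" using c r by (simp add: y_def)
  have t2: "t\<^sup>2 = y\<^sup>2 / (C * n)" using C n by (simp add: y2)
  have A0: "A > 0" and q0: "q > 0" using q by (auto simp: A_def)
  have L0: "L \<ge> 0" using K_nonneg q0 by (simp add: L_def)
  have M0: "M \<ge> 0" using C by (simp add: M_def)
  have e0: "e > 0" by (simp add: e_def)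
  have g: "y ^ j * e \<le> G" if "j \<le> 3" for j
    using gauss_le_cauchy[OF y that] by (simp add: e_def G_def y2)
  have G0: "G \<ge> 0" using g[of 0] e0 by simp
  have W: "W n t \<le> A * e"
  proof -
    have "q ^ min n N0 \<le> A" unfolding A_def using q by (intro power_increasing) auto
    then show ?thesis unfolding W_def e_def y2 by (simp add: mult_right_mono)
  qed
  have ph: "\<phi> n \<le> K * n" "0 \<le> \<phi> n" using phi[OF n] phi_nonneg by (auto simp: \<phi>_def)
  have b0: "norm (fourier_int (\<mu> n) t) \<le> A * e"
    using fourier_mu_bounds(1)[OF t] W by (rule order_trans)
  have b1: "norm (fourier_int (weight 1 (\<mu> n)) t) \<le> 2 * pi * q * K * A / c * r * (y * e)"
  proof -
    have "norm (fourier_int (weight 1 (\<mu> n)) t) \<le> 2 * pi * q * \<phi> n * \<bar>t\<bar> * W n t"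
      by (rule fourier_mu_bounds(2)[OF t])
    also have "\<dots> \<le> 2 * pi * q * (K * n) * \<bar>t\<bar> * (A * e)"
      using W ph q0 W_pos[of n t] K_nonneg by (intro mult_mono) (auto intro!: mult_nonneg_nonneg)
    also have "\<dots> = 2 * pi * q * K * A / c * r * (y * e)"
      unfolding ty r(2)[symmetric] using c(1) r(1) by (simp add: field_simps power2_eq_square)
    finally show ?thesis .
  qed
  have b2: "norm (fourier_int (weight 2 (\<mu> n)) t) \<le> (L + M * y\<^sup>2) * A * r\<^sup>2 * e"
  proof -
    have "norm (fourier_int (weight 2 (\<mu> n)) t) \<le> (q * \<phi> n + 4 * pi\<^sup>2 * q\<^sup>2 * (\<phi> n)\<^sup>2 * t\<^sup>2) * W n t"
      by (rule fourier_mu_bounds(3)[OF t])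
    also have "\<dots> \<le> (q * (K * n) + 4 * pi\<^sup>2 * q\<^sup>2 * (K * n)\<^sup>2 * t\<^sup>2) * (A * e)"
      using W ph q0 W_pos[of n t] K_nonneg
      by (intro mult_mono add_mono mult_left_mono mult_right_mono power_mono)
        (auto intro!: mult_nonneg_nonneg add_nonneg_nonneg)
    also have "\<dots> = (L + M * y\<^sup>2) * A * r\<^sup>2 * e"
      unfolding t2 r(2) L_def M_def using C n by (simp add: field_simps power2_eq_square)
    finally show ?thesis .
  qed
  have B27: "B / (1 + C * n * t\<^sup>2) = (A + A / c + 2 * pi * q * K * A / c + (L + M) * A * (1 + 1 / c)) * G"
    by (simp add: B_def G_def L_def M_def)
  define b where "b = A + A / c + 2 * pi * q * K * A / c + (L + M) * A * (1 + 1 / c)"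
  have parts: "A \<ge> 0" "A / c \<ge> 0" "2 * pi * q * K * A / c \<ge> 0" "(L + M) * A \<ge> 0" "(L + M) * A / c \<ge> 0"
    using A0 c q0 K_nonneg L0 M0 by auto
  have bb: "b = A + A / c + 2 * pi * q * K * A / c + (L + M) * A + (L + M) * A / c"
    by (simp add: b_def algebra_simps add_divide_distrib)
  have BG: "B / (1 + C * n * t\<^sup>2) = b * G" using B27 by (simp add: b_def)
  have Br: "B * x / (1 + C * n * t\<^sup>2) = b * (x * G)" "B / x / (1 + C * n * t\<^sup>2) = b * (G / x)" for x
  proof -
    have "B * x / (1 + C * n * t\<^sup>2) = B / (1 + C * n * t\<^sup>2) * x"
      "B / x / (1 + C * n * t\<^sup>2) = B / (1 + C * n * t\<^sup>2) / x" by (simp_all only: divide_inverse mult_ac)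
    then show "B * x / (1 + C * n * t\<^sup>2) = b * (x * G)" "B / x / (1 + C * n * t\<^sup>2) = b * (G / x)"
      unfolding BG by simp_all
  qed
  show "norm (fourier_int (\<mu> n) t) \<le> B / (1 + C * n * t\<^sup>2)"
  proof -
    have "A * e \<le> b * G" using g[of 0] parts G0 e0 unfolding bb by (intro mult_mono) auto
    then show ?thesis using b0 unfolding BG by simp
  qed
  show "norm (fourier_int (weight 1 (\<mu> n)) t) \<le> B * r / (1 + C * n * t\<^sup>2)"
  proof -
    have "2 * pi * q * K * A / c * r * (y * e) \<le> b * r * G"
      using g[of 1] parts G0 e0 r y unfolding bb by (intro mult_mono mult_right_mono) auto
    also have "\<dots> = B * r / (1 + C * n * t\<^sup>2)" by (simp only: Br mult.assoc[of b])
    finally show ?thesis using b1 by simp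
  qed
  \<comment> \<open>The second summand raises the degree by two, so \<open>j \<le> 1\<close> keeps
    it within three; \<open>j = 1\<close> accounts for an extra
    \<open>\<bar>t\<bar>\<close>.\<close>
  have LM: "(L + M * y\<^sup>2) * (y ^ j * e) \<le> (L + M) * G" if "j \<le> 1" for j
  proof -
    have "(L + M * y\<^sup>2) * (y ^ j * e) = L * (y ^ j * e) + M * (y ^ (j + 2) * e)"
      by (simp add: power_add power2_eq_square algebra_simps)
    also have "\<dots> \<le> L * G + M * G"
      using g[of j] g[of "j + 2"] that L0 M0 by (intro add_mono mult_left_mono) auto
    finally show ?thesis by (simp add: algebra_simps)
  qed
  show "norm (fourier_int (weight 2 (\<mu> n)) t) \<le> B * r\<^sup>2 / (1 + C * n * t\<^sup>2)"
  proof -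
    have "(L + M * y\<^sup>2) * A * r\<^sup>2 * e = A * r\<^sup>2 * ((L + M * y\<^sup>2) * (y ^ 0 * e))" by simp
    also have "\<dots> \<le> A * r\<^sup>2 * ((L + M) * G)" using LM[of 0] A0 by (intro mult_left_mono) auto
    also have "\<dots> = ((L + M) * A) * (r\<^sup>2 * G)" by simp
    also have "\<dots> \<le> b * (r\<^sup>2 * G)" using parts G0 unfolding bb by (intro mult_right_mono) auto
    also have "\<dots> = B * r\<^sup>2 / (1 + C * n * t\<^sup>2)" by (simp only: Br mult.assoc[of b])
    finally show ?thesis using b2 by simp
  qed
  show "\<bar>t\<bar> * norm (fourier_int (\<mu> n) t) \<le> B / r / (1 + C * n * t\<^sup>2)"
  proof -
    have "\<bar>t\<bar> * norm (fourier_int (\<mu> n) t) \<le> \<bar>t\<bar> * (A * e)" using b0 by (intro mult_left_mono) auto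
    also have "\<dots> = A / c * ((y * e) / r)" unfolding ty by simp
    also have "\<dots> \<le> b * (G / r)"
      using g[of 1] parts G0 e0 r y unfolding bb by (intro mult_mono divide_right_mono) auto
    also have "\<dots> = B / r / (1 + C * n * t\<^sup>2)" by (simp only: Br)
    finally show ?thesis .
  qed
  show "\<bar>t\<bar> * norm (fourier_int (weight 2 (\<mu> n)) t) \<le> B * r / (1 + C * n * t\<^sup>2)"
  proof -
    have "\<bar>t\<bar> * norm (fourier_int (weight 2 (\<mu> n)) t) \<le> \<bar>t\<bar> * ((L + M * y\<^sup>2) * A * r\<^sup>2 * e)"
      using b2 by (intro mult_left_mono) auto
    also have "\<dots> = A / c * r * ((L + M * y\<^sup>2) * (y ^ 1 * e))"
      unfolding ty using r(1) c(1) by (simp add: power2_eq_square field_simps)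
    also have "\<dots> \<le> A / c * r * ((L + M) * G)" using LM[of 1] A0 c r by (intro mult_left_mono) auto
    also have "\<dots> = ((L + M) * A / c) * (r * G)" by simp
    also have "\<dots> \<le> b * (r * G)" using parts G0 r unfolding bb by (intro mult_right_mono) auto
    also have "\<dots> = B * r / (1 + C * n * t\<^sup>2)" by (simp only: Br mult.assoc[of b])
    finally show ?thesis .
  qed
qed

text \<open>At \<open>n = 1\<close> and \<open>t = 0\<close> the first decay bound says that
  \<open>B\<close> dominates a norm.\<close>

lemma B_nonneg: "B \<ge> 0"
  using order_trans[OF norm_ge_zero fourier_mu_decay(1)[of 1 0]] by simp

text \<open>The 4 comes from \<open>kernel_decay\<close>, \<open>pi / c\<close> from the Cauchy
  integral with \<open>a = C * n\<close>, and \<open>2 * pi + 3\<close> is the largest coefficient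
  occurring, that of the second moment of the differences.\<close>

definition "D = 4 * (B * (2 * pi + 3) * pi / c)"

lemma D_nonneg: "D \<ge> 0"
  using B_nonneg C by (simp add: D_def c_def)

text \<open>\<open>kernel_decay\<close> is applied to \<open>\<mu> n\<close> and to its difference
  \<open>d\<close>. For \<open>d\<close> both inputs improve by \<open>1 / r\<close>, since the
  additional factor \<open>\<bar>t\<bar>\<close> is of order \<open>1 / r\<close> on the scale of
  the Gaussian.\<close>

lemma mu_bounds:
  assumes n: "n \<ge> 1"
  defines "r \<equiv> sqrt (real n)"
  shows "\<mu> n k \<le> D * (r / (r + \<bar>real_of_int k\<bar>)\<^sup>2)"
    and "\<bar>\<mu> n k - \<mu> n (k - 1)\<bar> \<le> D / r * (r / (r + \<bar>real_of_int k\<bar>)\<^sup>2)"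
proof -
  have c: "c > 0" using C by (auto simp: c_def)
  have r: "r > 0" "r\<^sup>2 = n" using n by (auto simp: r_def)
  have Cn: "C * n > 0" "sqrt (C * n) = c * r" using C n by (auto simp: real_sqrt_mult c_def r_def)
  note s = fin_m2_weight[OF mu_fin, of n]
  note F = fourier_mu_decay[OF n, folded r_def]
  have pos: "\<mu> n k \<ge> 0" for k using prob_on_intD(1)[OF mu_prob] .
  define H where "H = B * (2 * pi + 3) * pi / c"
  have BH: "B * x * pi / c \<le> H" if "x \<le> 2 * pi + 3" for x
    unfolding H_def using that B_nonneg c by (intro divide_right_mono mult_right_mono mult_left_mono) auto
  have DH: "D = 4 * H" by (simp add: D_def H_def)
  have "\<bar>\<mu> n k\<bar> \<le> B * pi / (c * r)"
    using fourier_coeff_cauchy_bound[OF s(1) Cn(1) B_nonneg F(1)] Cn(2) by simp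
  also have "\<dots> = (B * 1 * pi / c) / r" by simp
  also have "\<dots> \<le> H / r" using r by (intro divide_right_mono BH) (auto intro: add_nonneg_nonneg)
  finally have m0: "\<bar>\<mu> n k\<bar> \<le> H / r" .
  have "\<bar>weight 2 (\<mu> n) k\<bar> \<le> (B * r\<^sup>2) * pi / (c * r)"
    using fourier_coeff_cauchy_bound[OF s(3) Cn(1) _ F(3)] B_nonneg Cn(2) by simp
  also have "\<dots> = (B * 1 * pi / c) * r" using r(1) by (simp add: power2_eq_square)
  also have "\<dots> \<le> H * r" using r by (intro mult_right_mono BH) (auto intro: add_nonneg_nonneg)
  finally have m2: "(real_of_int k)\<^sup>2 * \<bar>\<mu> n k\<bar> \<le> H * r" by (simp add: weight_def abs_mult)
  show "\<mu> n k \<le> D * (r / (r + \<bar>real_of_int k\<bar>)\<^sup>2)"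
    using kernel_decay[OF r(1) m0 m2] pos[of k] by (simp add: DH)
  define d where "d = (\<lambda>k. \<mu> n k + (-1) * \<mu> n (k - 1))"
  have shift: "(\<lambda>k. g (k - 1)) summable_on UNIV" if "g summable_on UNIV" for g :: "int \<Rightarrow> real"
    using summable_on_reindex_bij_betw[of "\<lambda>k::int. k - 1" UNIV UNIV g] that
    by (simp add: bij_betw_def inj_on_def surj_def)
  have ds: "d summable_on UNIV"
    unfolding d_def by (intro summable_on_add summable_on_cmult_right shift s)
  have Fd: "fourier_int d t = (1 - cis (2 * pi * t)) * fourier_int (\<mu> n) t" for t
    unfolding d_def by (subst fourier_add, intro s, intro summable_on_cmult_right shift s,
        simp only: fourier_cmult fourier_shift) (simp add: algebra_simps)
  \<comment> \<open>Expand k^2 as (k - 1)^2 + 2 (k - 1) + 1 so that the shifted sequence is weighted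
    at its own argument.\<close>
  have d2: "weight 2 d = (\<lambda>k. weight 2 (\<mu> n) k + (-1) * (weight 2 (\<mu> n) (k - 1)
      + 2 * weight 1 (\<mu> n) (k - 1) + \<mu> n (k - 1)))"
    by (auto simp: fun_eq_iff weight_def d_def power2_eq_square algebra_simps)
  define S where "S = (\<lambda>k. weight 2 (\<mu> n) k + 2 * weight 1 (\<mu> n) k + \<mu> n k)"
  have Ss: "S summable_on UNIV" unfolding S_def by (intro summable_on_add summable_on_cmult_right s)
  have d2S: "weight 2 d = (\<lambda>k. weight 2 (\<mu> n) k + (-1) * S (k - 1))" by (simp only: d2 S_def)
  have d2s: "weight 2 d summable_on UNIV"
    unfolding d2S by (intro summable_on_add summable_on_cmult_right shift s Ss)
  have FS: "fourier_int S t = fourier_int (weight 2 (\<mu> n)) t + 2 * fourier_int (weight 1 (\<mu> n)) t + fourier_int (\<mu> n) t" for t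
    unfolding S_def
    by (simp add: fourier_add fourier_cmult s summable_on_add summable_on_cmult_right del: One_nat_def)
  have Fd2: "fourier_int (weight 2 d) t = (1 - cis (2 * pi * t)) * fourier_int (weight 2 (\<mu> n)) t
      - cis (2 * pi * t) * (2 * fourier_int (weight 1 (\<mu> n)) t + fourier_int (\<mu> n) t)" for t
    unfolding d2S by (subst fourier_add, intro s, intro summable_on_cmult_right shift Ss,
        simp only: fourier_cmult fourier_shift FS) (simp add: algebra_simps)
  have "norm (fourier_int d t) \<le> (B * (2 * pi) / r) / (1 + C * n * t\<^sup>2)" if t: "t \<in> {-1/2..1/2}" for t
  proof -
    have "norm (fourier_int d t) \<le> \<bar>2 * pi * t\<bar> * norm (fourier_int (\<mu> n) t)"
      unfolding Fd norm_mult by (intro mult_right_mono norm_cis_diff_le) auto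
    also have "\<dots> = 2 * pi * (\<bar>t\<bar> * norm (fourier_int (\<mu> n) t))" by (simp add: abs_mult)
    also have "\<dots> \<le> 2 * pi * (B / r / (1 + C * n * t\<^sup>2))" using F(4)[OF t] by (intro mult_left_mono) auto
    finally show ?thesis by (simp add: mult_ac)
  qed
  from fourier_coeff_cauchy_bound[OF ds Cn(1) _ this]
  have "\<bar>d k\<bar> \<le> (B * (2 * pi) / r) * pi / (c * r)" using B_nonneg r Cn(2) by simp
  also have "\<dots> = (B * (2 * pi) * pi / c) / r / r" by simp
  also have "\<dots> \<le> H / r / r" using r by (intro divide_right_mono BH) auto
  finally have d0: "\<bar>d k\<bar> \<le> H / r / r" .
  \<comment> \<open>The \<open>2 * pi\<close> stems from \<open>1 - cis (2 * pi * t)\<close>, the 3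
    from the coefficients 2 and 1 of the lower moments. As \<open>r \<ge> 1\<close>, these are of
    order \<open>r\<close> as well.\<close>
  have "norm (fourier_int (weight 2 d) t) \<le> (B * (2 * pi + 3) * r) / (1 + C * n * t\<^sup>2)" if t: "t \<in> {-1/2..1/2}" for t
  proof -
    have r1: "r \<ge> 1" using n by (simp add: r_def)
    have pos': "1 + C * n * t\<^sup>2 > 0" using Cn(1) by (intro add_pos_nonneg) auto
    have "norm (fourier_int (weight 2 d) t) \<le> norm ((1 - cis (2 * pi * t)) * fourier_int (weight 2 (\<mu> n)) t)
      + norm (cis (2 * pi * t) * (2 * fourier_int (weight 1 (\<mu> n)) t + fourier_int (\<mu> n) t))"
      unfolding Fd2 by (rule norm_triangle_ineq4)
    also have "\<dots> \<le> \<bar>2 * pi * t\<bar> * norm (fourier_int (weight 2 (\<mu> n)) t)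
      + (2 * norm (fourier_int (weight 1 (\<mu> n)) t) + norm (fourier_int (\<mu> n) t))"
      using norm_triangle_ineq[of "2 * fourier_int (weight 1 (\<mu> n)) t" "fourier_int (\<mu> n) t"]
      unfolding norm_mult norm_cis by (intro add_mono mult_right_mono norm_cis_diff_le) (auto simp: norm_mult)
    also have "\<dots> = 2 * pi * (\<bar>t\<bar> * norm (fourier_int (weight 2 (\<mu> n)) t))
      + 2 * norm (fourier_int (weight 1 (\<mu> n)) t) + norm (fourier_int (\<mu> n) t)" by (simp add: abs_mult)
    also have "\<dots> \<le> 2 * pi * (B * r / (1 + C * n * t\<^sup>2)) + 2 * (B * r / (1 + C * n * t\<^sup>2)) + B * r / (1 + C * n * t\<^sup>2)"
    proof -
      have "B / (1 + C * n * t\<^sup>2) \<le> B * r / (1 + C * n * t\<^sup>2)"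
        using r1 B_nonneg pos' mult_left_mono[of 1 r B] by (intro divide_right_mono) auto
      then show ?thesis
        using F(5)[OF t] F(2)[OF t] F(1)[OF t] by (intro add_mono mult_left_mono) auto
    qed
    also have "\<dots> = (2 * pi + 3) * (B * r / (1 + C * n * t\<^sup>2))"
    proof -
      have "2 * pi * x + 2 * x + x = (2 * pi + 3) * x" for x by (simp add: algebra_simps)
      then show ?thesis by (simp only:)
    qed
    also have "\<dots> = (B * (2 * pi + 3) * r) / (1 + C * n * t\<^sup>2)"
      by simp
    finally show ?thesis .
  qed
  from fourier_coeff_cauchy_bound[OF d2s Cn(1) _ this]
  have "\<bar>weight 2 d k\<bar> \<le> (B * (2 * pi + 3) * r) * pi / (c * r)"
    using B_nonneg r Cn(2) by (simp add: add_nonneg_nonneg)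
  also have "\<dots> = H / r * r" using r by (simp add: H_def)
  finally have d2: "(real_of_int k)\<^sup>2 * \<bar>d k\<bar> \<le> H / r * r" by (simp add: weight_def abs_mult)
  show "\<bar>\<mu> n k - \<mu> n (k - 1)\<bar> \<le> D / r * (r / (r + \<bar>real_of_int k\<bar>)\<^sup>2)"
    using kernel_decay[OF r(1) d0 d2] by (simp add: DH d_def)
qed

end

section \<open>Averages along a sequence\<close>

text \<open>Telescoping: with \<open>s = r + real N \<ge> 1\<close> the term
  \<open>r / s\<^sup>2\<close> is at most \<open>2 * r / s - 2 * r / (s + 1)\<close>.\<close>

lemma kernel_sum_bound:
  fixes r :: real
  assumes "r \<ge> 1"
  shows "(\<Sum>k<N. r / (r + real k)\<^sup>2) \<le> 2"
proof -
  have "(\<Sum>k<N. r / (r + real k)\<^sup>2) \<le> 2 - 2 * r / (r + real N)"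
  proof (induction N)
    case (Suc N)
    define s where "s = r + real N"
    have s: "s \<ge> 1" using assms by (simp add: s_def)
    have "r / s\<^sup>2 \<le> 2 * r / s - 2 * r / (s + 1)"
    proof -
      have "2 * r / s - 2 * r / (s + 1) = 2 * r / (s * (s + 1))" using s by (simp add: field_simps)
      moreover have "r / s\<^sup>2 \<le> 2 * r / (s * (s + 1))"
      proof -
        have "r / s\<^sup>2 = 2 * r / (s * (s + s))" using s by (simp add: field_simps power2_eq_square)
        also have "\<dots> \<le> 2 * r / (s * (s + 1))"
          using s assms by (intro divide_left_mono mult_left_mono mult_pos_pos) auto
        finally show ?thesis .
      qed
      ultimately show ?thesis by simp
    qed
    with Suc show ?case by (simp add: s_def add_ac)
  qed (use assms in simp)
  also have "\<dots> \<le> 2" using assms by simp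
  finally show ?thesis .
qed

lemma abel_sum_bound:
  fixes a w :: "nat \<Rightarrow> real"
  assumes S: "\<And>N. (\<Sum>k<N. a k) \<le> L * N" and w: "\<And>k. w k \<ge> 0" "\<And>k. w (Suc k) \<le> w k"
  shows "(\<Sum>k<N. w k * a k) \<le> L * (\<Sum>k<N. w k)"
proof -
  \<comment> \<open>Summation by parts as an invariant: the defect of the partial sums is never
    positive, so replacing \<open>w N\<close> by the smaller \<open>w (Suc N)\<close> can only raise
    the right side.\<close>
  have "(\<Sum>k<N. w k * (a k - L)) \<le> w N * ((\<Sum>k<N. a k) - L * N)"
  proof (induction N)
    case (Suc N)
    have "(\<Sum>k<Suc N. w k * (a k - L)) \<le> w N * ((\<Sum>k<N. a k) - L * N) + w N * (a N - L)"
      using Suc by simp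
    also have "\<dots> = w N * ((\<Sum>k<Suc N. a k) - L * Suc N)" by (simp add: algebra_simps)
    also have "\<dots> \<le> w (Suc N) * ((\<Sum>k<Suc N. a k) - L * Suc N)"
      using S[of "Suc N"] w(2) by (intro mult_right_mono_neg) auto
    finally show ?case .
  qed simp
  also have "\<dots> \<le> 0" using S[of N] w(1)[of N] by (intro mult_nonneg_nonpos) auto
  finally show ?thesis by (simp add: sum_distrib_left sum_subtractf algebra_simps)
qed

text \<open>Abel summation against the decreasing kernel, of sum at most 2, gives
  \<open>2 * L\<close> on each half line; the index 0 is counted in both. Since \<open>g\<close> may
  change sign, the differences of \<open>\<mu> n\<close> are covered too.\<close>

lemma kernel_average_bound:
  fixes a g :: "int \<Rightarrow> real"
  assumes r: "r \<ge> 1" and E: "E \<ge> 0"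
    and pos: "\<And>N. (\<Sum>k<N. \<bar>a (int k)\<bar>) \<le> L * real N"
    and neg: "\<And>N. (\<Sum>k<N. \<bar>a (- int k)\<bar>) \<le> L * real N"
    and g: "\<And>k. \<bar>g k\<bar> \<le> E * (r / (r + \<bar>real_of_int k\<bar>)\<^sup>2)"
  shows "(\<lambda>k. g k * a k) summable_on UNIV" and "\<bar>\<Sum>\<^sub>\<infinity>k. g k * a k\<bar> \<le> 4 * E * L"
proof -
  define w where "w k = r / (r + real k)\<^sup>2" for k :: nat
  have L: "L \<ge> 0" using pos[of 1] by simp
  have w: "w k \<ge> 0" "w (Suc k) \<le> w k" for k
    using r by (auto simp: w_def intro!: divide_left_mono power_mono mult_pos_pos)
  have ws: "(\<Sum>k<N. w k * b k) \<le> 2 * L" if "\<And>N. (\<Sum>k<N. b k) \<le> L * real N" for b and N :: nat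
  proof -
    have "(\<Sum>k<N. w k * b k) \<le> L * (\<Sum>k<N. w k)" by (rule abel_sum_bound) (use that w in auto)
    also have "\<dots> \<le> L * 2" using kernel_sum_bound[OF r, of N] L by (intro mult_left_mono) (auto simp: w_def)
    finally show ?thesis by simp
  qed
  define G where "G k = w (nat \<bar>k\<bar>) * \<bar>a k\<bar>" for k
  have G0: "G k \<ge> 0" for k by (simp add: G_def w)
  have fin: "sum G F \<le> 4 * L" if F: "finite F" for F
  proof -
    obtain N :: nat where N: "\<And>k. k \<in> F \<Longrightarrow> nat \<bar>k\<bar> < N"
      using finite_nat_set_iff_bounded[THEN iffD1, OF finite_imageI[OF F], of "\<lambda>k. nat \<bar>k\<bar>"] by auto
    define P where "P = int ` {..<N}"
    define Q where "Q = (\<lambda>k. - int k) ` {..<N}"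
    have "F \<subseteq> P \<union> Q"
    proof
      fix k assume "k \<in> F"
      from N[OF this] show "k \<in> P \<union> Q"
        by (cases "k \<ge> 0") (auto simp: P_def Q_def intro!: image_eqI[of _ _ "nat \<bar>k\<bar>"])
    qed
    then have "sum G F \<le> sum G (P \<union> Q)" by (intro sum_mono2) (auto simp: P_def Q_def G0)
    also have "\<dots> \<le> sum G P + sum G Q"
      using sum.union_inter[of P Q G] sum_nonneg[of "P \<inter> Q" G] G0 by (simp add: P_def Q_def)
    also have "sum G P = (\<Sum>k<N. w k * \<bar>a (int k)\<bar>)"
      unfolding P_def by (subst sum.reindex) (auto simp: G_def inj_on_def)
    also have "sum G Q = (\<Sum>k<N. w k * \<bar>a (- int k)\<bar>)"
      unfolding Q_def by (subst sum.reindex) (auto simp: G_def inj_on_def)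
    also have "(\<Sum>k<N. w k * \<bar>a (int k)\<bar>) + (\<Sum>k<N. w k * \<bar>a (- int k)\<bar>) \<le> 2 * L + 2 * L"
      by (intro add_mono ws pos neg)
    finally show ?thesis by simp
  qed
  have Gs: "G summable_on UNIV"
    by (rule nonneg_bdd_above_summable_on) (auto intro!: bdd_aboveI2 fin G0)
  have GL: "infsum G UNIV \<le> 4 * L" by (rule infsum_le_finite_sums[OF Gs]) (use fin in auto)
  have le: "norm (g k * a k) \<le> E * G k" for k
  proof -
    have "\<bar>g k\<bar> * \<bar>a k\<bar> \<le> (E * w (nat \<bar>k\<bar>)) * \<bar>a k\<bar>"
      using g[of k] by (intro mult_right_mono) (auto simp: w_def)
    then show ?thesis by (simp add: G_def abs_mult)
  qed
  have EG: "(\<lambda>k. E * G k) summable_on UNIV" using Gs by (rule summable_on_cmult_right)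
  show s: "(\<lambda>k. g k * a k) summable_on UNIV"
    by (rule abs_summable_summable, rule Infinite_Sum.abs_summable_on_comparison_test'[OF EG]) (use le in auto)
  have "\<bar>\<Sum>\<^sub>\<infinity>k. g k * a k\<bar> \<le> (\<Sum>\<^sub>\<infinity>k. E * G k)"
    using norm_infsum_le[OF has_sum_infsum[OF s] has_sum_infsum[OF EG]] le by simp
  also have "\<dots> = E * infsum G UNIV" by (simp add: infsum_cmult_right')
  also have "\<dots> \<le> E * (4 * L)" using GL E by (intro mult_left_mono)
  finally show "\<bar>\<Sum>\<^sub>\<infinity>k. g k * a k\<bar> \<le> 4 * E * L" by simp
qed

section \<open>Averages of a scalar sequence\<close>

context conv_sequence
begin

definition "avg n a = (\<Sum>\<^sub>\<infinity>k. \<mu> n k * a k)"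

text \<open>The bound does not depend on \<open>n\<close>: control of the one-sided ergodic averages
  in both directions controls all \<open>avg n\<close> at once.\<close>

lemma avg_maximal:
  assumes n: "n \<ge> 1"
    and pos: "\<And>N. (\<Sum>k<N. \<bar>a (int k)\<bar>) \<le> L * real N"
    and neg: "\<And>N. (\<Sum>k<N. \<bar>a (- int k)\<bar>) \<le> L * real N"
  shows "(\<lambda>k. \<mu> n k * a k) summable_on UNIV" and "\<bar>avg n a\<bar> \<le> 4 * D * L"
proof -
  have r: "sqrt (real n) \<ge> 1" using n by simp
  have g: "\<bar>\<mu> n k\<bar> \<le> D * (sqrt (real n) / (sqrt (real n) + \<bar>real_of_int k\<bar>)\<^sup>2)" for k
    using mu_bounds(1)[OF n] prob_on_intD(1)[OF mu_prob] by simp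
  show "(\<lambda>k. \<mu> n k * a k) summable_on UNIV" "\<bar>avg n a\<bar> \<le> 4 * D * L"
    unfolding avg_def by (rule kernel_average_bound[OF r D_nonneg pos neg g])+
qed

lemma avg_summable_bounded:
  assumes "\<And>k. \<bar>a k\<bar> \<le> b"
  shows "(\<lambda>k. \<mu> n k * a k) summable_on UNIV"
proof (rule abs_summable_summable, rule Infinite_Sum.abs_summable_on_comparison_test'[where g = "\<lambda>k. \<mu> n k * b"])
  show "(\<lambda>k. \<mu> n k * b) summable_on UNIV"
    by (intro summable_on_cmult_left prob_on_intD(2)[OF mu_prob])
  show "norm (\<mu> n k * a k) \<le> \<mu> n k * b" for k
    using assms[of k] prob_on_intD(1)[OF mu_prob] by (simp add: abs_mult mult_left_mono)
qed

lemma avg_add: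
  assumes "(\<lambda>k. \<mu> n k * a k) summable_on UNIV" and "(\<lambda>k. \<mu> n k * b k) summable_on UNIV"
  shows "(\<lambda>k. \<mu> n k * (a k + b k)) summable_on UNIV" and "avg n (\<lambda>k. a k + b k) = avg n a + avg n b"
  using summable_on_add[OF assms] infsum_add[OF assms] by (simp_all add: avg_def distrib_left)

lemma avg_cmult: "avg n (\<lambda>k. z * a k) = z * avg n a"
  unfolding avg_def by (subst infsum_cmult_right'[symmetric]) (simp add: mult_ac)

lemma avg_const: "avg n (\<lambda>_. z) = z"
  unfolding avg_def by (simp add: infsum_cmult_left' prob_on_intD(3)[OF mu_prob])

text \<open>Moving the shift onto \<open>\<mu> n\<close> leaves the differences
  \<open>\<mu> n k - \<mu> n (k - 1)\<close> as kernel, and their bound gains the factor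
  \<open>1 / sqrt (real n)\<close>.\<close>

lemma avg_shift_tendsto:
  assumes b: "\<And>k. \<bar>a k\<bar> \<le> b"
  shows "(\<lambda>n. avg n (\<lambda>k. a (k + 1)) - avg n a) \<longlonglongrightarrow> 0"
proof (rule Lim_null_comparison)
  have b0: "b \<ge> 0" using b[of 0] by simp
  have "norm (avg n (\<lambda>k. a (k + 1)) - avg n a) \<le> 4 * D * b / sqrt (real n)" if n: "n \<ge> 1" for n
  proof -
    have r: "sqrt (real n) \<ge> 1" using n by simp
    have "avg n (\<lambda>k. a (k + 1)) = (\<Sum>\<^sub>\<infinity>k. \<mu> n (k - 1) * a k)"
      unfolding avg_def
      by (rule infsum_reindex_bij_witness[where i = "\<lambda>k. k - 1" and j = "\<lambda>k. k + 1"]) auto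
    moreover have s1: "(\<lambda>k. \<mu> n (k - 1) * a k) summable_on UNIV"
      using avg_summable_bounded[of "\<lambda>k. a (k + 1)" b n] b
      by (subst summable_on_reindex_bij_witness[where i = "\<lambda>k. k + 1" and j = "\<lambda>k. k - 1"
            and h = "\<lambda>k. \<mu> n k * a (k + 1)" and T = UNIV]) auto
    moreover have s2: "(\<lambda>k. \<mu> n k * a k) summable_on UNIV" by (rule avg_summable_bounded[OF b])
    ultimately have "avg n (\<lambda>k. a (k + 1)) - avg n a = - (\<Sum>\<^sub>\<infinity>k. (\<mu> n k - \<mu> n (k - 1)) * a k)"
      using infsum_add[OF s2 summable_on_uminus[THEN iffD2, OF s1]] unfolding avg_def
      by (simp add: infsum_uminus left_diff_distrib)
    also have "\<bar>\<dots>\<bar> \<le> 4 * (D / sqrt (real n)) * b"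
      unfolding abs_minus_cancel
    proof (rule kernel_average_bound(2)[OF r])
      show "(\<Sum>k<N. \<bar>a (int k)\<bar>) \<le> b * real N" "(\<Sum>k<N. \<bar>a (- int k)\<bar>) \<le> b * real N" for N
        using sum_bounded_above[of "{..<N}" "\<lambda>k. \<bar>a (int k)\<bar>" b] sum_bounded_above[of "{..<N}" "\<lambda>k. \<bar>a (- int k)\<bar>" b] b
        by (simp_all add: mult.commute)
      show "\<bar>\<mu> n k - \<mu> n (k - 1)\<bar> \<le> D / sqrt (real n) * (sqrt (real n) / (sqrt (real n) + \<bar>real_of_int k\<bar>)\<^sup>2)" for k
        by (rule mu_bounds(2)[OF n])
    qed (use D_nonneg in simp)
    finally show ?thesis by simp
  qed
  then show "\<forall>\<^sub>F n in sequentially. norm (avg n (\<lambda>k. a (k + 1)) - avg n a) \<le> 4 * D * b / sqrt (real n)"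
    by (auto simp: eventually_sequentially)
  show "(\<lambda>n. 4 * D * b / sqrt (real n)) \<longlonglongrightarrow> 0"
    by (intro tendsto_divide_0[OF tendsto_const] filterlim_at_top_imp_at_infinity
        filterlim_compose[OF sqrt_at_top] filterlim_real_sequentially)
qed

lemma avg_shift_tendsto_nat:
  assumes b: "\<And>k. \<bar>a k\<bar> \<le> b"
  shows "(\<lambda>n. avg n (\<lambda>k. a (k + int j)) - avg n a) \<longlonglongrightarrow> 0"
proof (induction j)
  case (Suc j)
  have "(\<lambda>n. avg n (\<lambda>k. a (k + 1 + int j)) - avg n (\<lambda>k. a (k + int j))) \<longlonglongrightarrow> 0"
    by (rule avg_shift_tendsto[of "\<lambda>k. a (k + int j)" b]) (rule b)
  from tendsto_add[OF this Suc] show ?case by (simp add: add_ac)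
qed simp

end

section \<open>Maximal and mean ergodic theorems\<close>

locale measure_preserving_map = prob_space M for M :: "'a measure" +
  fixes T :: "'a \<Rightarrow> 'a"
  assumes T [measurable]: "T \<in> measurable M M" and pres: "distr M M T = M"
begin

lemma T_space: "x \<in> space M \<Longrightarrow> T x \<in> space M"
  using measurable_space[OF T] .

lemma integral_comp:
  assumes "integrable M (g :: 'a \<Rightarrow> real)"
  shows "integrable M (\<lambda>x. g (T x))" and "(\<integral>x. g (T x) \<partial>M) = (\<integral>x. g x \<partial>M)"
proof -
  have [measurable]: "g \<in> borel_measurable M" using assms by simp
  show "integrable M (\<lambda>x. g (T x))"
    using assms integrable_distr[OF T, of g] by (simp add: pres)
  show "(\<integral>x. g (T x) \<partial>M) = (\<integral>x. g x \<partial>M)"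
    using integral_distr[OF T, of g] by (simp add: pres)
qed

lemma preserving_funpow: "measure_preserving_map M (T ^^ k)"
proof (induction k)
  case 0
  show ?case by unfold_locales (simp_all add: id_def distr_id)
next
  case (Suc k)
  interpret k: measure_preserving_map M "T ^^ k" by fact
  have "distr M M (T \<circ> T ^^ k) = distr (distr M M (T ^^ k)) M T"
    by (rule distr_distr[symmetric]) (auto simp: k.T)
  then have "distr M M (T ^^ Suc k) = M" by (simp only: funpow.simps k.pres pres)
  moreover have "T ^^ Suc k \<in> measurable M M" using measurable_comp[OF k.T T] by (simp only: funpow.simps)
  ultimately show ?case by (intro measure_preserving_map.intro measure_preserving_map_axioms.intro prob_space_axioms)
qed

lemma funpow_measurable [measurable]: "T ^^ k \<in> measurable M M"
  using preserving_funpow measure_preserving_map.T by blast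

section \<open>Birkhoff sums and the maximal ergodic theorem\<close>

definition birk :: "('a \<Rightarrow> real) \<Rightarrow> nat \<Rightarrow> 'a \<Rightarrow> real" where
  "birk g N x = (\<Sum>k<N. g ((T ^^ k) x))"

text \<open>This is the maximum of \<open>birk g N x\<close> over \<open>N \<le> n\<close>. The
  recursive form is the identity on which the maximal ergodic theorem rests.\<close>

primrec maxsum :: "('a \<Rightarrow> real) \<Rightarrow> nat \<Rightarrow> 'a \<Rightarrow> real" where
  "maxsum g 0 = (\<lambda>x. 0)"
| "maxsum g (Suc n) = (\<lambda>x. max 0 (g x + maxsum g n (T x)))"

lemma birk_0 [simp]: "birk g 0 x = 0" by (simp add: birk_def)

lemma birk_Suc: "birk g (Suc N) x = g x + birk g N (T x)"
  unfolding birk_def by (simp add: sum.lessThan_Suc_shift funpow_swap1 del: sum.lessThan_Suc)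

lemma birk_measurable [measurable]: "g \<in> borel_measurable M \<Longrightarrow> birk g N \<in> borel_measurable M"
  unfolding birk_def[abs_def]
  by (intro borel_measurable_sum measurable_compose[OF funpow_measurable])

lemma maxsum_nonneg: "0 \<le> maxsum g n x" by (cases n) auto

lemma maxsum_mono: "maxsum g n x \<le> maxsum g (Suc n) x"
proof (induction n arbitrary: x)
  case (Suc n)
  from Suc[of "T x"] show ?case by simp
qed (simp add: maxsum_nonneg)

lemma birk_le_maxsum: "birk g n x \<le> maxsum g n x"
proof (induction n arbitrary: x)
  case (Suc n)
  from Suc[of "T x"] show ?case by (simp add: birk_Suc)
qed simp

lemma maxsum_eq_birk: "\<exists>N. maxsum g n x = birk g N x"
proof (induction n arbitrary: x)
  case 0
  show ?case by (intro exI[of _ 0]) simp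
next
  case (Suc n)
  from Suc[of "T x"] obtain N where N: "maxsum g n (T x) = birk g N (T x)" by blast
  show ?case
  proof (cases "g x + maxsum g n (T x) \<le> 0")
    case True
    then show ?thesis by (intro exI[of _ 0]) simp
  next
    case False
    then show ?thesis by (intro exI[of _ "Suc N"]) (simp add: birk_Suc N)
  qed
qed

lemma maxsum_integrable: "integrable M g \<Longrightarrow> integrable M (maxsum g n)"
  by (induction n) (auto intro!: integrable_max integral_comp)

text \<open>Garsia's argument. Where \<open>maxsum g (Suc m)\<close> is positive it equals
  \<open>g\<close> plus \<open>maxsum g m\<close> after \<open>T\<close>; elsewhere it vanishes. As
  \<open>T\<close> preserves integrals and \<open>maxsum\<close> increases with its index,
  integrating over \<open>E n\<close> gives the claim there, and dominated convergence passes to the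
  union.\<close>

theorem maximal_ergodic:
  assumes g: "integrable M g"
  shows "0 \<le> (\<integral>x. indicator {x \<in> space M. \<exists>N. birk g N x > 0} x * g x \<partial>M)"
proof -
  have [measurable]: "g \<in> borel_measurable M" using g by simp
  have [measurable]: "maxsum g n \<in> borel_measurable M" for n using maxsum_integrable[OF g] by simp
  define E where "E n = {x \<in> space M. maxsum g n x > 0}" for n
  have [measurable]: "E n \<in> sets M" for n unfolding E_def by measurable
  have i: "integrable M (\<lambda>x. indicator (E n) x * g x)" for n
    using integrable_mult_indicator[OF _ g, of "E n"] by simp
  have nn: "0 \<le> (\<integral>x. indicator (E n) x * g x \<partial>M)" for n
  proof (cases n)
    case 0
    then show ?thesis by (simp add: E_def)
  next
    case (Suc m)
    note c = integral_comp[OF maxsum_integrable[OF g]]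
    have "0 \<le> (\<integral>x. maxsum g n x - maxsum g m x \<partial>M)"
      using maxsum_mono[of g m] by (intro Bochner_Integration.integral_nonneg) (simp add: Suc del: maxsum.simps)
    also have "\<dots> = (\<integral>x. maxsum g n x - maxsum g m (T x) \<partial>M)"
      by (simp add: c maxsum_integrable[OF g])
    also have "\<dots> \<le> (\<integral>x. indicator (E n) x * g x \<partial>M)"
    proof (rule integral_mono)
      fix x assume x: "x \<in> space M"
      show "maxsum g n x - maxsum g m (T x) \<le> indicator (E n) x * g x"
        using x maxsum_nonneg[of g m "T x"] by (auto simp: E_def Suc indicator_def max_def)
    qed (auto intro!: i c Bochner_Integration.integrable_diff maxsum_integrable[OF g])
    finally show ?thesis .
  qed
  have E: "{x \<in> space M. \<exists>N. birk g N x > 0} = (\<Union>n. E n)"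
  proof (intro equalityI subsetI)
    fix x assume "x \<in> {x \<in> space M. \<exists>N. birk g N x > 0}"
    then obtain N where "x \<in> space M" "birk g N x > 0" by blast
    with birk_le_maxsum[of g N x] have "x \<in> E N" by (simp add: E_def)
    then show "x \<in> (\<Union>n. E n)" by blast
  next
    fix x assume "x \<in> (\<Union>n. E n)"
    then obtain n where n: "x \<in> space M" "maxsum g n x > 0" by (auto simp: E_def)
    obtain N where "maxsum g n x = birk g N x" using maxsum_eq_birk by blast
    with n show "x \<in> {x \<in> space M. \<exists>N. birk g N x > 0}" by auto
  qed
  have "incseq E"
    unfolding E_def by (intro incseq_SucI subsetI CollectI conjI)
      (auto simp del: maxsum.simps intro: less_le_trans[OF _ maxsum_mono])
  have "(\<lambda>n. \<integral>x. indicator (E n) x * g x \<partial>M) \<longlonglongrightarrow> (\<integral>x. indicator (\<Union>n. E n) x * g x \<partial>M)"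
  proof (rule integral_dominated_convergence[where w = "\<lambda>x. \<bar>g x\<bar>"])
    show "AE x in M. (\<lambda>n. indicator (E n) x * g x) \<longlonglongrightarrow> indicator (\<Union>n. E n) x * g x"
      using LIMSEQ_indicator_incseq[OF \<open>incseq E\<close>] by (intro AE_I2 tendsto_mult tendsto_const) auto
    show "AE x in M. norm (indicator (E n) x * g x) \<le> \<bar>g x\<bar>" for n
      by (auto simp: indicator_def)
  qed (use g in auto)
  from LIMSEQ_le_const[OF this] nn show ?thesis unfolding E by blast
qed

text \<open>The set where the ergodic maximal function of \<open>\<bar>h\<bar>\<close> exceeds
  \<open>l\<close>. Without division, \<open>N = 0\<close> needs no exception: its inequality is
  false.\<close>

definition maximal_set :: "('a \<Rightarrow> real) \<Rightarrow> real \<Rightarrow> 'a set" where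
  "maximal_set h l = {x \<in> space M. \<exists>N. l * real N < (\<Sum>k<N. \<bar>h ((T ^^ k) x)\<bar>)}"

lemma maximal_set_measurable [measurable]:
  assumes [measurable]: "h \<in> borel_measurable M"
  shows "maximal_set h l \<in> sets M"
proof -
  have [measurable]: "(\<lambda>x. h ((T ^^ k) x)) \<in> borel_measurable M" for k
    by (rule measurable_compose[OF funpow_measurable]) simp
  show ?thesis unfolding maximal_set_def by measurable
qed

text \<open>The maximal ergodic theorem for \<open>\<bar>h\<bar> - l\<close>, whose Birkhoff sums
  are positive for some \<open>N\<close> exactly on \<open>maximal_set h l\<close>.\<close>

theorem weak_type:
  assumes h: "integrable M h" and l: "l > 0"
  shows "l * measure M (maximal_set h l) \<le> (\<integral>x. \<bar>h x\<bar> \<partial>M)"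
proof -
  have [measurable]: "h \<in> borel_measurable M" using h by simp
  define g where "g = (\<lambda>x. \<bar>h x\<bar> - l)"
  have g: "integrable M g" unfolding g_def using h by auto
  have E: "{x \<in> space M. \<exists>N. birk g N x > 0} = maximal_set h l"
    by (auto simp: maximal_set_def birk_def g_def sum_subtractf mult.commute)
  have iE: "integrable M (\<lambda>x. indicator (maximal_set h l) x * \<bar>h x\<bar>)"
    using integrable_mult_indicator[OF maximal_set_measurable, of h "\<lambda>x. \<bar>h x\<bar>"] h by simp
  have "0 \<le> (\<integral>x. indicator (maximal_set h l) x * g x \<partial>M)"
    using maximal_ergodic[OF g] by (simp add: E)
  also have "\<dots> = (\<integral>x. indicator (maximal_set h l) x * \<bar>h x\<bar> - l * indicator (maximal_set h l) x \<partial>M)"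
    by (simp add: g_def algebra_simps)
  also have "\<dots> = (\<integral>x. indicator (maximal_set h l) x * \<bar>h x\<bar> \<partial>M) - l * measure M (maximal_set h l)"
    using iE by (subst Bochner_Integration.integral_diff)
      (auto intro!: integrable_real_indicator simp: less_top[symmetric])
  also have "(\<integral>x. indicator (maximal_set h l) x * \<bar>h x\<bar> \<partial>M) \<le> (\<integral>x. \<bar>h x\<bar> \<partial>M)"
    using iE h by (intro integral_mono) (auto simp: indicator_def)
  finally show ?thesis by simp
qed

section \<open>Limits of ergodic averages of bounded functions\<close>

definition upper :: "('a \<Rightarrow> real) \<Rightarrow> 'a \<Rightarrow> ereal" where
  "upper f x = limsup (\<lambda>N. ereal (birk f N x / real N))"

lemma upper_measurable [measurable]: "f \<in> borel_measurable M \<Longrightarrow> upper f \<in> borel_measurable M"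
  unfolding upper_def[abs_def]
  by (intro borel_measurable_limsup borel_measurable_ereal borel_measurable_divide birk_measurable borel_measurable_const)

lemma birk_Suc_right: "birk f (Suc N) x = birk f N x + f ((T ^^ N) x)"
  by (simp add: birk_def)

text \<open>The averages at \<open>T x\<close> and at \<open>x\<close> differ by two values of
  \<open>f\<close> divided by \<open>N\<close>. Boundedness makes this vanish at every point, so no
  exceptional set arises.\<close>

lemma upper_invariant:
  assumes b: "\<And>x. \<bar>f x\<bar> \<le> b"
  shows "upper f (T x) = upper f x"
proof -
  define e where "e N = (f ((T ^^ N) x) - f x) / real N" for N
  have "e \<longlonglongrightarrow> 0"
  proof (rule Lim_null_comparison)
    show "\<forall>\<^sub>F N in sequentially. norm (e N) \<le> 2 * b / real N"
    proof (intro always_eventually allI)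
      fix N
      have "\<bar>f ((T ^^ N) x) - f x\<bar> \<le> 2 * b" using b[of "(T ^^ N) x"] b[of x] by linarith
      then show "norm (e N) \<le> 2 * b / real N" by (simp add: e_def divide_right_mono)
    qed
    show "(\<lambda>N. 2 * b / real N) \<longlonglongrightarrow> 0" by (rule lim_const_over_n)
  qed
  then have "(\<lambda>N. ereal (e N)) \<longlonglongrightarrow> ereal 0" by simp
  from ereal_limsup_lim_add[OF this, of "\<lambda>N. ereal (birk f N x / real N)"]
  have "limsup (\<lambda>N. ereal (e N) + ereal (birk f N x / real N)) = upper f x"
    by (simp add: upper_def)
  moreover have "ereal (e N) + ereal (birk f N x / real N) = ereal (birk f N (T x) / real N)" for N
    using birk_Suc[of f N x] birk_Suc_right[of f N x] by (simp add: e_def add_divide_distrib[symmetric])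
  ultimately show ?thesis by (simp add: upper_def)
qed

lemma birk_uminus: "birk (\<lambda>x. - f x) N x = - birk f N x"
  by (simp add: birk_def sum_negf)

lemma birk_abs_le:
  assumes b: "\<And>x. \<bar>f x\<bar> \<le> b"
  shows "\<bar>birk f N x / real N\<bar> \<le> b"
proof -
  have b0: "b \<ge> 0" using b[of x] by linarith
  have "\<bar>birk f N x\<bar> \<le> (\<Sum>k<N. \<bar>f ((T ^^ k) x)\<bar>)" unfolding birk_def by (rule sum_abs)
  also have "\<dots> \<le> b * N" using sum_bounded_above[of "{..<N}" "\<lambda>k. \<bar>f ((T ^^ k) x)\<bar>" b] b by (simp add: mult.commute)
  finally show ?thesis using b0 by (cases "N = 0") (auto simp: field_simps)
qed

lemma integrable_bounded:
  assumes [measurable]: "f \<in> borel_measurable M" and b: "\<And>x. \<bar>f x\<bar> \<le> b"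
  shows "integrable M (f :: 'a \<Rightarrow> real)"
  by (rule integrable_const_bound[of _ b]) (use b in auto)

text \<open>On an invariant set where the upper limit of the averages exceeds \<open>\<beta>\<close>, some partial sum of
  \<open>f - \<beta>\<close> is positive at every point, so the maximal ergodic theorem bounds the integral from below.\<close>

lemma integral_nonneg_on_invariant:
  assumes [measurable]: "f \<in> borel_measurable M" "E \<in> sets M" and b: "\<And>x. \<bar>f x\<bar> \<le> b"
    and inv: "\<And>x. x \<in> space M \<Longrightarrow> T x \<in> E \<longleftrightarrow> x \<in> E"
    and up: "\<And>x. x \<in> E \<Longrightarrow> ereal \<beta> < upper f x"
  shows "0 \<le> (\<integral>x. indicator E x * (f x - \<beta>) \<partial>M)"
proof -
  define g where "g x = indicator E x * (f x - \<beta>)" for x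
  have gb: "\<bar>g x\<bar> \<le> b + \<bar>\<beta>\<bar>" for x
    using b[of x] by (auto simp: g_def indicator_def)
  have g: "integrable M g"
    by (rule integrable_bounded[OF _ gb]) (simp add: g_def[abs_def])
  have orbit: "(T ^^ k) x \<in> space M \<and> ((T ^^ k) x \<in> E \<longleftrightarrow> x \<in> E)" if "x \<in> space M" for k x
    using that by (induction k) (auto simp: T_space inv)
  have S: "birk g N x = indicator E x * (birk f N x - \<beta> * real N)" if "x \<in> space M" for N x
    using orbit[OF that] by (auto simp: birk_def g_def indicator_def sum_subtractf)
  have ES: "E \<subseteq> space M" by (rule sets.sets_into_space) simp
  have "{x \<in> space M. \<exists>N. birk g N x > 0} = E"
  proof (intro equalityI subsetI)
    fix x assume "x \<in> {x \<in> space M. \<exists>N. birk g N x > 0}"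
    then show "x \<in> E" by (cases "x \<in> E") (auto simp: S)
  next
    fix x assume x: "x \<in> E"
    \<comment> \<open>\<open>N \<ge> 1\<close> has to be secured: at \<open>N = 0\<close> the
      quotient has the default value 0 and says nothing about a sum.\<close>
    have "\<exists>N. ereal \<beta> < ereal (birk f N x / real N) \<and> N \<ge> 1"
    proof (rule ccontr)
      assume "\<not> ?thesis"
      then have "\<forall>\<^sub>F N in sequentially. ereal (birk f N x / real N) \<le> ereal \<beta>"
        by (auto simp: eventually_sequentially not_less intro!: exI[of _ 1])
      from Limsup_bounded[OF this] up[OF x] show False by (simp add: upper_def)
    qed
    then obtain N where "\<beta> < birk f N x / real N" "N \<ge> 1" by auto
    then have "birk g N x > 0" using x ES by (auto simp: S field_simps)
    then show "x \<in> {x \<in> space M. \<exists>N. birk g N x > 0}" using x ES by auto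
  qed
  with maximal_ergodic[OF g] have "0 \<le> (\<integral>x. indicator E x * g x \<partial>M)" by simp
  also have "(\<lambda>x. indicator E x * g x) = (\<lambda>x. indicator E x * (f x - \<beta>))"
    by (auto simp: g_def indicator_def)
  finally show ?thesis .
qed

text \<open>The lower limit is expressed as \<open>- upper (\<lambda>x. - f x) x\<close>. Where it
  lies below \<open>\<alpha>\<close> and the upper limit above \<open>\<beta> > \<alpha>\<close>,
  the set is invariant; the integral of \<open>f\<close> over it is at least \<open>\<beta>\<close>
  and at most \<open>\<alpha>\<close> times its measure, which is therefore 0. Rational pairs
  suffice.\<close>

lemma upper_le_lower_AE:
  assumes [measurable]: "f \<in> borel_measurable M" and b: "\<And>x. \<bar>f x\<bar> \<le> b"
  shows "AE x in M. upper f x \<le> - upper (\<lambda>x. - f x) x"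
proof -
  have null: "AE x in M. \<not> (- upper (\<lambda>x. - f x) x < ereal \<alpha> \<and> ereal \<beta> < upper f x)" if ab: "\<alpha> < \<beta>" for \<alpha> \<beta>
  proof -
    define E where "E = {x \<in> space M. - upper (\<lambda>x. - f x) x < ereal \<alpha> \<and> ereal \<beta> < upper f x}"
    have [measurable]: "E \<in> sets M" unfolding E_def by measurable
    have b': "\<And>x. \<bar>- f x\<bar> \<le> b" using b by simp
    have inv: "T x \<in> E \<longleftrightarrow> x \<in> E" if "x \<in> space M" for x
      using that upper_invariant[OF b] upper_invariant[of "\<lambda>x. - f x", OF b'] T_space by (simp add: E_def)
    have 1: "0 \<le> (\<integral>x. indicator E x * (f x - \<beta>) \<partial>M)"
      by (rule integral_nonneg_on_invariant[OF _ _ b inv]) (auto simp: E_def)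
    have 2: "0 \<le> (\<integral>x. indicator E x * (- f x - (- \<alpha>)) \<partial>M)"
      by (rule integral_nonneg_on_invariant[OF _ _ b' inv]) (auto simp: E_def ereal_uminus_less_reorder)
    have bd: "\<bar>indicator E x * (f x - \<beta>)\<bar> \<le> b + \<bar>\<beta>\<bar>" "\<bar>indicator E x * (- f x - (- \<alpha>))\<bar> \<le> b + \<bar>\<alpha>\<bar>" for x
      using b[of x] by (auto simp: indicator_def)
    have i: "integrable M (\<lambda>x. indicator E x * (f x - \<beta>))" "integrable M (\<lambda>x. indicator E x * (- f x - (- \<alpha>)))"
      by (rule integrable_bounded[OF _ bd(1)], measurable) (rule integrable_bounded[OF _ bd(2)], measurable)
    have "0 \<le> (\<integral>x. indicator E x * (f x - \<beta>) + indicator E x * (- f x - (- \<alpha>)) \<partial>M)"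
      using 1 2 i by simp
    also have "\<dots> = (\<integral>x. (\<alpha> - \<beta>) * indicator E x \<partial>M)" by (simp add: algebra_simps)
    also have "\<dots> = (\<alpha> - \<beta>) * measure M E" by simp
    finally have "measure M E = 0"
      using ab measure_nonneg[of M E] by (auto simp: zero_le_mult_iff)
    then have "E \<in> null_sets M" by (simp add: null_sets_def emeasure_eq_measure)
    then show ?thesis by (rule AE_I') (auto simp: E_def)
  qed
  have "AE x in M. \<forall>\<alpha> \<beta> :: rat. \<alpha> < \<beta> \<longrightarrow>
      \<not> (- upper (\<lambda>x. - f x) x < ereal (of_rat \<alpha>) \<and> ereal (of_rat \<beta>) < upper f x)"
    unfolding AE_all_countable
  proof (intro allI)
    fix \<alpha> \<beta> :: rat
    show "AE x in M. \<alpha> < \<beta> \<longrightarrow>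
      \<not> (- upper (\<lambda>x. - f x) x < ereal (of_rat \<alpha>) \<and> ereal (of_rat \<beta>) < upper f x)"
      using null[of "of_rat \<alpha>" "of_rat \<beta>"] by (cases "\<alpha> < \<beta>") (simp_all add: of_rat_less)
  qed
  then show ?thesis
  proof eventually_elim
    fix x assume *: "\<forall>\<alpha> \<beta> :: rat. \<alpha> < \<beta> \<longrightarrow>
      \<not> (- upper (\<lambda>x. - f x) x < ereal (of_rat \<alpha>) \<and> ereal (of_rat \<beta>) < upper f x)"
    show "upper f x \<le> - upper (\<lambda>x. - f x) x"
    proof (rule ccontr)
      assume "\<not> ?thesis"
      then have "- upper (\<lambda>x. - f x) x < upper f x" by (simp only: not_le)
      then obtain \<beta> where \<beta>: "- upper (\<lambda>x. - f x) x < ereal (of_rat \<beta>)" "ereal (of_rat \<beta>) < upper f x"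
        using ereal_dense3 by blast
      obtain \<alpha> where \<alpha>: "- upper (\<lambda>x. - f x) x < ereal (of_rat \<alpha>)" "ereal (of_rat \<alpha>) < ereal (of_rat \<beta>)"
        using ereal_dense3[OF \<beta>(1)] by blast
      from \<alpha>(2) have "\<alpha> < \<beta>" by (simp add: of_rat_less)
      with * \<alpha>(1) \<beta>(2) show False by blast
    qed
  qed
qed

text \<open>Almost everywhere convergence plus dominated convergence. Taking \<open>F\<close> from
  the upper limit makes it invariant at every point, which is what evaluation along whole orbits
  requires.\<close>

theorem mean_ergodic_bounded:
  assumes [measurable]: "f \<in> borel_measurable M" and b: "\<And>x. \<bar>f x\<bar> \<le> b"
  obtains F where "F \<in> borel_measurable M" and "\<And>x. \<bar>F x\<bar> \<le> b" and "\<And>x. F (T x) = F x"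
    and "(\<lambda>N. \<integral>x. \<bar>birk f N x / real N - F x\<bar> \<partial>M) \<longlonglongrightarrow> 0"
proof
  define F where "F x = real_of_ereal (upper f x)" for x
  show [measurable]: "F \<in> borel_measurable M" unfolding F_def[abs_def] by measurable
  show "F (T x) = F x" for x by (simp add: F_def upper_invariant[OF b])
  have ub: "ereal (- b) \<le> upper f x" "upper f x \<le> ereal b" for x
  proof -
    note bb = birk_abs_le[where f = f and x = x, OF b]
    show "upper f x \<le> ereal b"
      unfolding upper_def by (intro Limsup_bounded always_eventually allI) (use bb in \<open>simp only: abs_le_iff ereal_less_eq\<close>)
    show "ereal (- b) \<le> upper f x"
      unfolding upper_def
      by (rule order_trans[OF Liminf_bounded Liminf_le_Limsup])
        (use bb in \<open>auto intro!: always_eventually simp: abs_le_iff minus_le_iff simp del: abs_divide\<close>)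
  qed
  have F: "ereal (F x) = upper f x" for x
    using ub[of x] by (cases "upper f x") (auto simp: F_def)
  show Fb: "\<bar>F x\<bar> \<le> b" for x using ub[of x] unfolding F[symmetric] by (simp add: abs_le_iff)
  have conv: "AE x in M. (\<lambda>N. birk f N x / real N) \<longlonglongrightarrow> F x"
    using upper_le_lower_AE[OF assms]
  proof eventually_elim
    fix x assume le: "upper f x \<le> - upper (\<lambda>x. - f x) x"
    have "- upper (\<lambda>x. - f x) x = liminf (\<lambda>N. ereal (birk f N x / real N))"
      using ereal_Liminf_uminus[of sequentially "\<lambda>N. ereal (birk (\<lambda>x. - f x) N x / real N)"]
      by (simp add: upper_def birk_uminus)
    with le have "ereal (F x) \<le> liminf (\<lambda>N. ereal (birk f N x / real N))" by (simp add: F)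
    moreover have "limsup (\<lambda>N. ereal (birk f N x / real N)) \<le> ereal (F x)" by (simp add: F upper_def)
    ultimately show "(\<lambda>N. birk f N x / real N) \<longlonglongrightarrow> F x"
      by (intro limsup_le_liminf_real)
  qed
  have "(\<lambda>N. \<integral>x. \<bar>birk f N x / real N - F x\<bar> \<partial>M) \<longlonglongrightarrow> (\<integral>x. 0 \<partial>M)"
  proof (rule integral_dominated_convergence[where w = "\<lambda>x. 2 * b"])
    show "AE x in M. (\<lambda>N. \<bar>birk f N x / real N - F x\<bar>) \<longlonglongrightarrow> 0"
      using conv by eventually_elim (rule tendsto_rabs_zero, rule LIM_zero)
    show "AE x in M. norm \<bar>birk f N x / real N - F x\<bar> \<le> 2 * b" for N
    proof (rule AE_I2)
      fix x show "norm \<bar>birk f N x / real N - F x\<bar> \<le> 2 * b"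
        using birk_abs_le[where f = f and x = x and N = N, OF b] Fb[of x]
          abs_triangle_ineq4[of "birk f N x / real N" "F x"] unfolding real_norm_def abs_idempotent by linarith
    qed
  qed auto
  then show "(\<lambda>N. \<integral>x. \<bar>birk f N x / real N - F x\<bar> \<partial>M) \<longlonglongrightarrow> 0" by simp
qed

end

section \<open>Almost everywhere convergence\<close>

context conv_sequence
begin

lemma avg_sum:
  fixes N :: nat
  assumes "\<And>j. j < N \<Longrightarrow> (\<lambda>k. \<mu> n k * g j k) summable_on UNIV"
  shows "(\<lambda>k. \<mu> n k * (\<Sum>j<N. g j k)) summable_on UNIV \<and> avg n (\<lambda>k. \<Sum>j<N. g j k) = (\<Sum>j<N. avg n (g j))"
  using assms
proof (induction N)
  case 0
  show ?case by (simp add: avg_def)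
next
  case (Suc N)
  then have "(\<lambda>k. \<mu> n k * (\<Sum>j<N. g j k)) summable_on UNIV \<and> avg n (\<lambda>k. \<Sum>j<N. g j k) = (\<Sum>j<N. avg n (g j))"
    by simp
  with avg_add[of n "\<lambda>k. \<Sum>j<N. g j k" "g N"] Suc.prems[of N] show ?case by simp
qed

text \<open>The sequence minus its mean over \<open>N\<close> consecutive shifts is a mean of
  differences \<open>a k - a (k + int j)\<close>, each annihilated in the limit by shift
  asymptotics.\<close>

lemma avg_coboundary_tendsto:
  assumes b: "\<And>k. \<bar>a k\<bar> \<le> b" and N: "N \<ge> 1"
  shows "(\<lambda>k. \<mu> n k * (a k - (\<Sum>j<N. a (k + int j)) / real N)) summable_on UNIV"
    and "(\<lambda>n. avg n (\<lambda>k. a k - (\<Sum>j<N. a (k + int j)) / real N)) \<longlonglongrightarrow> 0"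
proof -
  have e: "a k - (\<Sum>j<N. a (k + int j)) / real N = (\<Sum>j<N. (- 1 / real N) * (a (k + int j) + (-1) * a k))" for k
    unfolding sum_distrib_left[symmetric] using N by (simp add: sum_subtractf field_simps)
  have s: "(\<lambda>k. \<mu> n k * a (k + int j)) summable_on UNIV" for n j
    by (rule avg_summable_bounded) (rule b)
  have s': "(\<lambda>k. \<mu> n k * ((-1) * a k)) summable_on UNIV" for n
    by (rule avg_summable_bounded[where b = b]) (simp add: b)
  note ad = avg_add[OF s s']
  have s2: "(\<lambda>k. \<mu> n k * ((- 1 / real N) * (a (k + int j) + (-1) * a k))) summable_on UNIV" for n j
    using summable_on_cmult_right[OF ad(1), of "- 1 / real N"] by (simp only: mult.left_commute)
  note as = avg_sum[where g = "\<lambda>j k. (- 1 / real N) * (a (k + int j) + (-1) * a k)", OF s2]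
  show "(\<lambda>k. \<mu> n k * (a k - (\<Sum>j<N. a (k + int j)) / real N)) summable_on UNIV"
    unfolding e using as by blast
  have "avg n (\<lambda>k. a k - (\<Sum>j<N. a (k + int j)) / real N)
      = (\<Sum>j<N. (- 1 / real N) * (avg n (\<lambda>k. a (k + int j)) - avg n a))" for n
    unfolding e as[THEN conjunct2] avg_cmult ad(2) by simp
  moreover have "(\<lambda>n. \<Sum>j<N. (- 1 / real N) * (avg n (\<lambda>k. a (k + int j)) - avg n a)) \<longlonglongrightarrow> (\<Sum>j<N. (- 1 / real N) * 0)"
    by (intro tendsto_sum tendsto_mult tendsto_const avg_shift_tendsto_nat[OF b])
  ultimately show "(\<lambda>n. avg n (\<lambda>k. a k - (\<Sum>j<N. a (k + int j)) / real N)) \<longlonglongrightarrow> 0" by simp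
qed

end

section \<open>Approximation of integrable functions\<close>

context measure_preserving_map
begin

lemma L1_truncation:
  assumes f: "integrable M (f :: 'a \<Rightarrow> real)" and e: "e > 0"
  obtains b B where "b \<in> borel_measurable M" and "\<And>x. \<bar>b x\<bar> \<le> B" and "(\<integral>x. \<bar>f x - b x\<bar> \<partial>M) < e"
proof -
  have [measurable]: "f \<in> borel_measurable M" using f by simp
  define b where "b m x = max (- real m) (min (f x) (real m))" for m x
  have [measurable]: "b m \<in> borel_measurable M" for m unfolding b_def[abs_def] by measurable
  have "(\<lambda>m. \<integral>x. \<bar>f x - b m x\<bar> \<partial>M) \<longlonglongrightarrow> (\<integral>x. 0 \<partial>M)"
  proof (rule integral_dominated_convergence[where w = "\<lambda>x. \<bar>f x\<bar>"])
    show "AE x in M. (\<lambda>m. \<bar>f x - b m x\<bar>) \<longlonglongrightarrow> 0"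
    proof (rule AE_I2)
      fix x
      obtain m0 :: nat where m0: "\<bar>f x\<bar> \<le> real m0" using real_arch_simple by blast
      have "\<bar>f x - b m x\<bar> = 0" if "m \<ge> m0" for m
      proof -
        have "\<bar>f x\<bar> \<le> real m" using m0 that by linarith
        then have "- real m \<le> f x" "f x \<le> real m" by linarith+
        then show ?thesis by (simp add: b_def max_def min_def)
      qed
      then have "\<forall>\<^sub>F m in sequentially. \<bar>f x - b m x\<bar> = 0" unfolding eventually_sequentially by blast
      then show "(\<lambda>m. \<bar>f x - b m x\<bar>) \<longlonglongrightarrow> 0" by (rule tendsto_eventually)
    qed
    show "AE x in M. norm \<bar>f x - b m x\<bar> \<le> \<bar>f x\<bar>" for m
      by (rule AE_I2) (auto simp: b_def max_def min_def)
  qed (use f in auto)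
  then have "(\<lambda>m. \<integral>x. \<bar>f x - b m x\<bar> \<partial>M) \<longlonglongrightarrow> 0" by simp
  from order_tendstoD(2)[OF this e] obtain m where "(\<integral>x. \<bar>f x - b m x\<bar> \<partial>M) < e"
    by (auto simp: eventually_sequentially)
  then show thesis by (intro that[of "b m" "real m"]) (auto simp: b_def)
qed

text \<open>Truncate \<open>f\<close> to a bounded \<open>b\<close> and choose \<open>N\<close> such
  that the averages of \<open>b\<close> are close to their limit \<open>F\<close>. The two errors
  form \<open>h\<close>. The identity holds at every point, so it can be read along orbits.\<close>

lemma L1_decomposition:
  assumes f: "integrable M (f :: 'a \<Rightarrow> real)" and e: "e > 0"
  obtains b F h B N where "\<And>x. \<bar>b x\<bar> \<le> B" and "\<And>x. F (T x) = F x" and "N \<ge> 1"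
    and "integrable M h" and "(\<integral>x. \<bar>h x\<bar> \<partial>M) < e"
    and "\<And>x. f x = h x + (b x - birk b N x / real N) + F x"
proof -
  have [measurable]: "f \<in> borel_measurable M" using f by simp
  obtain b B where [measurable]: "b \<in> borel_measurable M" and B: "\<And>x. \<bar>b x\<bar> \<le> B"
    and bf: "(\<integral>x. \<bar>f x - b x\<bar> \<partial>M) < e / 2"
    by (rule L1_truncation[OF f, of "e / 2"]) (use e in auto)
  obtain F where [measurable]: "F \<in> borel_measurable M" and F: "\<And>x. \<bar>F x\<bar> \<le> B" and inv: "\<And>x. F (T x) = F x"
    and lim: "(\<lambda>N. \<integral>x. \<bar>birk b N x / real N - F x\<bar> \<partial>M) \<longlonglongrightarrow> 0"
    using mean_ergodic_bounded[OF \<open>b \<in> borel_measurable M\<close> B] by blast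
  from order_tendstoD(2)[OF lim, of "e / 2"] e
  obtain N0 where N0: "\<And>N. N \<ge> N0 \<Longrightarrow> (\<integral>x. \<bar>birk b N x / real N - F x\<bar> \<partial>M) < e / 2"
    by (auto simp: eventually_sequentially)
  define N where "N = max 1 N0"
  define h where "h x = (f x - b x) + (birk b N x / real N - F x)" for x
  have i1: "integrable M (\<lambda>x. f x - b x)"
    by (intro Bochner_Integration.integrable_diff f integrable_bounded[OF _ B]) simp
  have i2: "integrable M (\<lambda>x. birk b N x / real N - F x)"
    by (intro Bochner_Integration.integrable_diff integrable_bounded[OF _ birk_abs_le[OF B]] integrable_bounded[OF _ F])
      simp_all
  have "(\<integral>x. \<bar>h x\<bar> \<partial>M) \<le> (\<integral>x. \<bar>f x - b x\<bar> + \<bar>birk b N x / real N - F x\<bar> \<partial>M)"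
    using i1 i2 unfolding h_def by (intro integral_mono) auto
  also have "\<dots> = (\<integral>x. \<bar>f x - b x\<bar> \<partial>M) + (\<integral>x. \<bar>birk b N x / real N - F x\<bar> \<partial>M)"
    using i1 i2 by simp
  also have "\<dots> < e" using bf N0[of N] by (simp add: N_def)
  finally have "(\<integral>x. \<bar>h x\<bar> \<partial>M) < e" .
  moreover have "integrable M h" unfolding h_def[abs_def] using i1 i2 by (rule Bochner_Integration.integrable_add)
  ultimately show thesis
    by (intro that[of b B F N h] B inv) (auto simp: N_def h_def)
qed

end

lemma (in finite_measure) AE_small_exceptions:
  assumes "\<And>e. e > 0 \<Longrightarrow> \<exists>S\<in>sets M. measure M S \<le> e \<and> (\<forall>x\<in>space M - S. P x)"
  shows "AE x in M. P x"
proof -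
  have "\<exists>S. S \<in> sets M \<and> measure M S \<le> 1 / real (Suc i) \<and> (\<forall>x\<in>space M - S. P x)" for i
    using assms[of "1 / real (Suc i)"] by (simp only: Bex_def) simp
  then obtain S where "S i \<in> sets M \<and> measure M (S i) \<le> 1 / real (Suc i) \<and> (\<forall>x\<in>space M - S i. P x)" for i
    by metis
  then have S: "\<And>i. S i \<in> sets M" "\<And>i. measure M (S i) \<le> 1 / real (Suc i)"
    "\<And>i x. x \<in> space M - S i \<Longrightarrow> P x"
    by blast+
  define Z where "Z = (\<Inter>i. S i)"
  have Z: "Z \<in> sets M" unfolding Z_def using S(1) by auto
  have "measure M Z \<le> 1 / real (Suc i)" for i
    using finite_measure_mono[of Z "S i"] S(1,2)[of i] by (auto simp: Z_def intro: order_trans)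
  then have "measure M Z \<le> 0"
    by (intro LIMSEQ_le_const[OF LIMSEQ_inverse_real_of_nat]) (auto simp: inverse_eq_divide)
  then have "Z \<in> null_sets M" using Z measure_nonneg[of M Z] by (simp add: null_sets_def emeasure_eq_measure)
  then show ?thesis by (rule AE_I') (use S(3) in \<open>auto simp: Z_def\<close>)
qed

section \<open>Two-sided orbits\<close>

lemma tpow_int [simp]: "tpow M \<tau> (int k) = \<tau> ^^ k"
  by (simp add: tpow_def)

lemma tpow_minus_int [simp]: "tpow M \<tau> (- int k) = inv_into (space M) \<tau> ^^ k"
  by (cases "k = 0") (simp_all add: tpow_def)

lemma tpow_add_one:
  assumes bij: "bij_betw \<tau> (space M) (space M)" and x: "x \<in> space M"
  shows "tpow M \<tau> (k + 1) x = \<tau> (tpow M \<tau> k x)"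
proof (cases "k \<ge> 0")
  case True
  then obtain j where "k = int j" using nonneg_int_cases by blast
  then have "tpow M \<tau> (k + 1) = \<tau> ^^ Suc j" "tpow M \<tau> k = \<tau> ^^ j"
    using tpow_int[of M \<tau> "Suc j"] by (simp_all add: add.commute del: funpow.simps)
  then show ?thesis by simp
next
  case False
  define \<sigma> where "\<sigma> = inv_into (space M) \<tau>"
  from False obtain j where k: "k = - int (Suc j)"
    by (metis add.commute linorder_not_le neg_int_cases not0_implies_Suc of_nat_0_less_iff not_gr_zero)
  have "tpow M \<tau> (k + 1) = \<sigma> ^^ j" "tpow M \<tau> k = \<sigma> ^^ Suc j"
    using tpow_minus_int[of M \<tau> j] tpow_minus_int[of M \<tau> "Suc j"] by (simp_all add: k \<sigma>_def del: funpow.simps)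
  moreover have "(\<sigma> ^^ j) x \<in> space M"
    using x bij_betw_inv_into[OF bij] by (induction j) (auto simp: \<sigma>_def dest: bij_betwE)
  ultimately show ?thesis
    using bij by (simp add: \<sigma>_def f_inv_into_f bij_betw_def)
qed

lemma tpow_add_nat:
  assumes "bij_betw \<tau> (space M) (space M)" and "x \<in> space M"
  shows "tpow M \<tau> (k + int j) x = (\<tau> ^^ j) (tpow M \<tau> k x)"
  using tpow_add_one[OF assms, of "k + int j" for j] by (induction j) (simp_all add: add_ac)

lemma tpow_invariant:
  assumes "bij_betw \<tau> (space M) (space M)" and "x \<in> space M" and inv: "\<And>x. F (\<tau> x) = F x"
  shows "F (tpow M \<tau> k x) = F x"
proof (induction k rule: int_induct[where k = 0])
  case base
  show ?case using tpow_int[of M \<tau> 0] by simp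
next
  case (step1 i)
  then show ?case by (simp add: tpow_add_one[OF assms(1,2)] inv)
next
  case (step2 i)
  then show ?case using tpow_add_one[OF assms(1,2), of "i - 1"] inv by simp
qed

lemma invertible_mptD:
  assumes "prob_space M" and "invertible_mpt M \<tau>"
  shows "measure_preserving_map M \<tau>" and "measure_preserving_map M (inv_into (space M) \<tau>)" and "bij_betw \<tau> (space M) (space M)"
  using assms by (auto simp: invertible_mpt_def measure_preserving_map_def measure_preserving_map_axioms_def)

context conv_sequence
begin

text \<open>Off \<open>S\<close> the part from \<open>h\<close> is at most \<open>l / 4\<close> by
  the maximal inequalities for \<open>\<tau>\<close> and its inverse; the coboundary part is
  eventually below \<open>l / 4\<close>; the invariant part is constant along the orbit and cancels.
  Two averages thus differ by at most \<open>l\<close>.\<close>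

lemma oscillation_bound:
  assumes M: "prob_space M" and \<tau>: "invertible_mpt M \<tau>" and f: "integrable M (f :: 'a \<Rightarrow> real)"
    and l: "l > 0" and e: "e > 0"
  shows "\<exists>S\<in>sets M. measure M S \<le> e \<and> (\<forall>x\<in>space M - S.
      (\<forall>n\<ge>1. (\<lambda>k. \<mu> n k * f (tpow M \<tau> k x)) summable_on UNIV) \<and>
      (\<exists>N1. \<forall>n\<ge>N1. \<forall>m\<ge>N1. \<bar>avg n (\<lambda>k. f (tpow M \<tau> k x)) - avg m (\<lambda>k. f (tpow M \<tau> k x))\<bar> \<le> l))"
proof -
  define \<sigma> where "\<sigma> = inv_into (space M) \<tau>"
  interpret T: measure_preserving_map M \<tau> by (rule invertible_mptD(1)[OF M \<tau>])
  interpret R: measure_preserving_map M \<sigma> unfolding \<sigma>_def by (rule invertible_mptD(2)[OF M \<tau>])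
  note bij = invertible_mptD(3)[OF M \<tau>]
  \<comment> \<open>Chosen for \<open>4 * D * L \<le> l / 4\<close>; the added 16 keeps the
    denominator positive when \<open>D = 0\<close>.\<close>
  define L where "L = l / (16 * D + 16)"
  have D16: "16 * D + 16 > 0" using D_nonneg by simp
  have L: "L > 0" using l D16 by (simp add: L_def)
  have DL: "4 * D * L \<le> l / 4"
  proof -
    have "4 * D * L \<le> (4 * D + 4) * L" using L by simp
    also have "\<dots> = l / 4" using D16 by (simp add: L_def field_simps)
    finally show ?thesis .
  qed
  \<comment> \<open>The weak type inequality bounds each of the two maximal sets by
    \<open>\<eta> / L = e / 2\<close>.\<close>
  define \<eta> where "\<eta> = e * L / 2"
  have \<eta>: "\<eta> > 0" using e L by (simp add: \<eta>_def)
  obtain b F h B N where B: "\<And>x. \<bar>b x\<bar> \<le> B" and F: "\<And>x. F (\<tau> x) = F x" and N: "N \<ge> 1"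
    and h: "integrable M h" and h\<eta>: "(\<integral>x. \<bar>h x\<bar> \<partial>M) < \<eta>"
    and dec: "\<And>x. f x = h x + (b x - T.birk b N x / real N) + F x"
    by (rule T.L1_decomposition[OF f \<eta>]) blast
  have hm: "h \<in> borel_measurable M" using h by simp
  define S where "S = T.maximal_set h L \<union> R.maximal_set h L"
  have S: "S \<in> sets M" unfolding S_def
    by (intro sets.Un T.maximal_set_measurable R.maximal_set_measurable hm)
  have "measure M S \<le> measure M (T.maximal_set h L) + measure M (R.maximal_set h L)"
    unfolding S_def by (intro measure_subadditive) (auto simp: T.maximal_set_measurable R.maximal_set_measurable hm)
  moreover have "measure M (T.maximal_set h L) \<le> \<eta> / L" "measure M (R.maximal_set h L) \<le> \<eta> / L"
    using T.weak_type[OF h L] R.weak_type[OF h L] h\<eta> L by (simp_all add: field_simps)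
  ultimately have Se: "measure M S \<le> e" using L by (simp add: \<eta>_def)
  show ?thesis
  proof (intro bexI[of _ S] conjI ballI Se S)
    fix x assume x: "x \<in> space M - S"
    then have xM: "x \<in> space M" by simp
    define a where "a k = tpow M \<tau> k x" for k
    have pos: "(\<Sum>k<N. \<bar>h (a (int k))\<bar>) \<le> L * real N" for N
      using x by (auto simp: S_def T.maximal_set_def a_def not_less)
    have "a (- int k) = (\<sigma> ^^ k) x" for k by (simp add: a_def \<sigma>_def)
    then have neg: "(\<Sum>k<N. \<bar>h (a (- int k))\<bar>) \<le> L * real N" for N
      using x by (auto simp: S_def R.maximal_set_def not_less)
    have birk: "T.birk b N (a k) = (\<Sum>j<N. b (a (k + int j)))" for k
      unfolding T.birk_def a_def tpow_add_nat[OF bij xM] ..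
    have fa: "f (a k) = h (a k) + ((b (a k) - (\<Sum>j<N. b (a (k + int j))) / real N) + F x)" for k
      unfolding dec[of "a k"] birk using tpow_invariant[OF bij xM, of F, OF F] by (simp add: a_def)
    define c where "c k = b (a k) - (\<Sum>j<N. b (a (k + int j))) / real N" for k
    have cs: "(\<lambda>k. \<mu> n k * c k) summable_on UNIV" for n
      unfolding c_def by (rule avg_coboundary_tendsto(1)[OF B N])
    have ct: "(\<lambda>n. avg n c) \<longlonglongrightarrow> 0"
      unfolding c_def by (rule avg_coboundary_tendsto(2)[OF B N])
    have Fs: "(\<lambda>k. \<mu> n k * F x) summable_on UNIV" for n
      by (rule avg_summable_bounded[of _ "\<bar>F x\<bar>"]) simp
    have hs: "(\<lambda>k. \<mu> n k * h (a k)) summable_on UNIV" "\<bar>avg n (\<lambda>k. h (a k))\<bar> \<le> 4 * D * L" if "n \<ge> 1" for n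
      using avg_maximal[OF that pos neg] by auto
    have fs: "(\<lambda>k. \<mu> n k * f (a k)) summable_on UNIV"
      and fe: "avg n (\<lambda>k. f (a k)) = avg n (\<lambda>k. h (a k)) + (avg n c + F x)" if "n \<ge> 1" for n
      using avg_add[OF hs(1)[OF that] avg_add(1)[OF cs Fs]]
      unfolding fa c_def[symmetric] avg_add(2)[OF cs Fs] avg_const by auto
    from order_tendstoD(1)[OF ct, of "- l / 4"] order_tendstoD(2)[OF ct, of "l / 4"] l
    have "\<forall>\<^sub>F n in sequentially. \<bar>avg n c\<bar> < l / 4"
      by (auto elim: eventually_elim2)
    then obtain N1 where N1: "\<And>n. n \<ge> N1 \<Longrightarrow> \<bar>avg n c\<bar> < l / 4" by (auto simp: eventually_sequentially)
    have "\<bar>avg n (\<lambda>k. f (a k)) - avg m (\<lambda>k. f (a k))\<bar> \<le> l" if "n \<ge> max 1 N1" "m \<ge> max 1 N1" for n m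
      using that hs(2)[of n] hs(2)[of m] fe[of n] fe[of m] N1[of n] N1[of m] DL by auto
    then show "\<exists>N1. \<forall>n\<ge>N1. \<forall>m\<ge>N1. \<bar>avg n (\<lambda>k. f (tpow M \<tau> k x)) - avg m (\<lambda>k. f (tpow M \<tau> k x))\<bar> \<le> l"
      unfolding a_def by blast
    show "\<forall>n\<ge>1. (\<lambda>k. \<mu> n k * f (tpow M \<tau> k x)) summable_on UNIV"
      using fs unfolding a_def by blast
  qed
qed

text \<open>Oscillation bounds \<open>1 / real (Suc i)\<close> for all \<open>i\<close>
  simultaneously give the Cauchy property almost everywhere.\<close>

lemma avg_AE_convergent:
  assumes M: "prob_space M" and \<tau>: "invertible_mpt M \<tau>" and f: "integrable M (f :: 'a \<Rightarrow> real)"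
  shows "AE x in M. (\<forall>n. (\<lambda>k. \<mu> n k * f (tpow M \<tau> k x)) summable_on UNIV) \<and>
    convergent (\<lambda>n. avg n (\<lambda>k. f (tpow M \<tau> k x)))"
proof -
  interpret prob_space M by (rule M)
  have "AE x in M. (\<forall>n\<ge>1. (\<lambda>k. \<mu> n k * f (tpow M \<tau> k x)) summable_on UNIV) \<and>
      (\<exists>N1. \<forall>n\<ge>N1. \<forall>m\<ge>N1. \<bar>avg n (\<lambda>k. f (tpow M \<tau> k x)) - avg m (\<lambda>k. f (tpow M \<tau> k x))\<bar> \<le> 1 / real (Suc i))" for i
  proof (rule AE_small_exceptions)
    fix e :: real assume "e > 0"
    have i: "1 / real (Suc i) > 0" by simp
    show "\<exists>S\<in>sets M. measure M S \<le> e \<and> (\<forall>x\<in>space M - S.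
      (\<forall>n\<ge>1. (\<lambda>k. \<mu> n k * f (tpow M \<tau> k x)) summable_on UNIV) \<and>
      (\<exists>N1. \<forall>n\<ge>N1. \<forall>m\<ge>N1. \<bar>avg n (\<lambda>k. f (tpow M \<tau> k x)) - avg m (\<lambda>k. f (tpow M \<tau> k x))\<bar> \<le> 1 / real (Suc i)))"
      by (rule oscillation_bound[OF M \<tau> f i \<open>e > 0\<close>])
  qed
  then have "AE x in M. \<forall>i. (\<forall>n\<ge>1. (\<lambda>k. \<mu> n k * f (tpow M \<tau> k x)) summable_on UNIV) \<and>
      (\<exists>N1. \<forall>n\<ge>N1. \<forall>m\<ge>N1. \<bar>avg n (\<lambda>k. f (tpow M \<tau> k x)) - avg m (\<lambda>k. f (tpow M \<tau> k x))\<bar> \<le> 1 / real (Suc i))"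
    by (simp only: AE_all_countable simp_thms)
  then show ?thesis
  proof eventually_elim
    fix x
    let ?u = "\<lambda>n. avg n (\<lambda>k. f (tpow M \<tau> k x))"
    assume *: "\<forall>i. (\<forall>n\<ge>1. (\<lambda>k. \<mu> n k * f (tpow M \<tau> k x)) summable_on UNIV) \<and>
      (\<exists>N1. \<forall>n\<ge>N1. \<forall>m\<ge>N1. \<bar>?u n - ?u m\<bar> \<le> 1 / real (Suc i))"
    have "(\<lambda>k. \<mu> n k * f (tpow M \<tau> k x)) summable_on UNIV" for n
    \<comment> \<open>At \<open>n = 0\<close> the measure is the point mass at 0, to which the
      kernel bounds do not extend.\<close>
    proof (cases n)
      case 0
      then show ?thesis
        by (auto intro!: finite_nonzero_values_imp_summable_on intro: finite_subset[of _ "{0}"])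
    next
      case (Suc m)
      then show ?thesis using * by (simp del: mu_conv.simps)
    qed
    moreover have "Cauchy ?u"
    proof (rule metric_CauchyI)
      fix e :: real assume "e > 0"
      then obtain i where i: "1 / real (Suc i) < e" using reals_Archimedean[of e] by (auto simp: inverse_eq_divide)
      obtain N1 where N1: "\<forall>n\<ge>N1. \<forall>m\<ge>N1. \<bar>?u n - ?u m\<bar> \<le> 1 / real (Suc i)" using * by blast
      have "dist (?u m) (?u n) < e" if "m \<ge> N1" "n \<ge> N1" for m n
        using N1[rule_format, OF that] i unfolding dist_real_def by (rule le_less_trans)
      then show "\<exists>N1. \<forall>m\<ge>N1. \<forall>n\<ge>N1. dist (?u m) (?u n) < e" by blast
    qed
    ultimately show "(\<forall>n. (\<lambda>k. \<mu> n k * f (tpow M \<tau> k x)) summable_on UNIV) \<and> convergent ?u"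
      by (simp add: Cauchy_convergent)
  qed
qed

end

text \<open>Below the threshold \<open>N\<close> of the Landau symbol, monotonicity bounds
  \<open>u n\<close> by \<open>u N\<close>, which makes the linear bound valid from
  \<open>n = 1\<close>.\<close>

lemma bigo_linear_bound:
  fixes u :: "nat \<Rightarrow> real"
  assumes "u \<in> O(\<lambda>n. real n)" and mono: "mono u"
  obtains K where "\<And>n. n \<ge> 1 \<Longrightarrow> u n \<le> K * real n"
proof -
  from landau_o.bigE[OF assms(1)] obtain c where c: "c > 0" "\<forall>\<^sub>F n in sequentially. norm (u n) \<le> c * norm (real n)" by blast
  then obtain N where N: "\<And>n. n \<ge> N \<Longrightarrow> \<bar>u n\<bar> \<le> c * real n" by (auto simp: eventually_sequentially)
  have "u n \<le> (c + \<bar>u N\<bar>) * real n" if n: "n \<ge> 1" for n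
  proof (cases "n \<ge> N")
    case True
    have "u n \<le> c * real n" using N[OF True] by simp
    also have "\<dots> \<le> (c + \<bar>u N\<bar>) * real n" by (intro mult_right_mono) auto
    finally show ?thesis .
  next
    case False
    then have "u n \<le> \<bar>u N\<bar>" using monoD[OF mono, of n N] by simp
    also have "\<dots> \<le> c + \<bar>u N\<bar>" using c by simp
    also have "\<dots> \<le> (c + \<bar>u N\<bar>) * real n" using n c mult_left_mono[of 1 "real n" "c + \<bar>u N\<bar>"] by simp
    finally show ?thesis .
  qed
  then show thesis by (rule that)
qed

theorem theorem2p2p2:
  fixes M :: "'a measure" and \<tau> :: "'a \<Rightarrow> 'a" and \<nu> :: "nat \<Rightarrow> int \<Rightarrow> real"
    and f :: "'a \<Rightarrow> real"
  assumes "prob_space M" and "non_atomic M" and "separable_measure M"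
    and "invertible_mpt M \<tau>"
    and prob: "\<And>n. n \<ge> 1 \<Longrightarrow> prob_on_int (\<nu> n)"
    and aper: "\<And>n. n \<ge> 1 \<Longrightarrow> strictly_aperiodic (\<nu> n)"
    and mom2: "\<And>n. n \<ge> 1 \<Longrightarrow> (\<lambda>k. (real_of_int k)\<^sup>2 * \<nu> n k) summable_on UNIV"
    and mean0: "\<And>n. n \<ge> 1 \<Longrightarrow> mean_int (\<nu> n) = 0"
    and phi: "(\<lambda>n. \<Sum>i=1..n. m2 (\<nu> i)) \<in> O(\<lambda>n. real n)"
    and four: "\<exists>C>0. \<exists>N0::nat>0. \<forall>n>N0. \<forall>t\<in>{-1/2..<1/2}.
                 norm (fourier_int (\<nu> n) t) \<le> exp (- C * t\<^sup>2)"
    and f: "integrable M f"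
  shows "AE x in M. (\<forall>n. (\<lambda>k. mu_conv \<nu> n k * f (tpow M \<tau> k x)) summable_on UNIV) \<and>
           convergent (\<lambda>n. \<Sum>\<^sub>\<infinity>k. mu_conv \<nu> n k * f (tpow M \<tau> k x))"
proof -
  have "mono (\<lambda>n. \<Sum>i=1..n. m2 (\<nu> i))"
    by (intro monoI sum_mono2) (auto intro!: m2_nonneg prob)
  from bigo_linear_bound[OF phi this]
  obtain K where K: "\<And>n. n \<ge> 1 \<Longrightarrow> (\<Sum>i=1..n. m2 (\<nu> i)) \<le> K * real n" by blast
  from four obtain C N0 where C: "C > 0"
    and decay: "\<And>n t. n > N0 \<Longrightarrow> t \<in> {-1/2..<1/2} \<Longrightarrow> norm (fourier_int (\<nu> n) t) \<le> exp (- C * t\<^sup>2)"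
    by blast
  interpret conv_sequence \<nu> C K N0
  proof
    fix n :: nat and t :: real assume n: "n > N0" and t: "t \<in> {-1/2..1/2}"
    show "norm (fourier_int (\<nu> n) t) \<le> exp (- C * t\<^sup>2)"
    \<comment> \<open>Only the right endpoint is missing; by periodicity the bound at
      \<open>-1/2\<close> applies, where the square of \<open>t\<close> is the same.\<close>
    proof (cases "t = 1/2")
      case True
      show ?thesis unfolding True fourier_half
        using decay[OF n, of "-1/2"] by (simp add: power2_eq_square)
    next
      case False
      with t show ?thesis by (intro decay[OF n]) auto
    qed
  qed (use prob mom2 mean0 C K in \<open>auto simp: fin_m2_def weight_def[abs_def] prob_on_intD\<close>)
  show ?thesis using avg_AE_convergent[OF assms(1,4) f] by (simp only: avg_def)
qed

end
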